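(* Let $\Delta t>0$, $u_h^0=\Pi u_0\in V_h$ and $U_h^0=\Pi\sqrt{F(u_0)+B}\in V_h$. For $n\ge 0$ consider the following scheme: given $u_h^n,U_h^n\in V_h$, find $(u_h^{n+1},w_h^{n+1},U_h^{n+1})\in V_h\times V_h\times V_h$ such that for all $\phi,\psi,\tau\in V_h$ $$\left(\frac{u_h^{n+1}-u_h^n}{\Delta t},\phi\right)=-A(M(u_h^n);w_h^{n+1},\phi),$$ $$(w_h^{n+1},\psi)=A(\epsilon^2;u_h^{n+1},\psi)+\left(H(u_h^n)U_h^{n+1},\psi\right),$$ $$\left(\frac{U_h^{n+1}-U_h^n}{\Delta t},\tau\right)=\frac12\left(H(u_h^n)\frac{u_h^{n+1}-u_h^n}{\Delta t},\tau\right).$$ Then for any $\Delta t>0$ the scheme admits a unique solution $(u_h^{n+1},w_h^{n+1},U_h^{n+1})\in V_h\times V_h\times V_h$. The solution satisfies total mass conservation $\int_\Omega u_h^n\,dx=\int_\Omega u_h^0\,dx$ for any $n>0$. Additionally, it satisfies, independently of the size of the time step $\Delta t$, the energy dissipation law $$E(u_h^{n+1},U_h^{n+1})=E(u_h^n,U_h^n)-\|U_h^{n+1}-U_h^n\|^2-\Delta t\,A(M(u_h^n);w_h^{n+1},w_h^{n+1})-\frac12A(\epsilon^2;u_h^{n+1}-u_h^n,u_h^{n+1}-u_h^n).$$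
   Context: $\Omega\subset\mathbb{R}^d$ ($d=2,3$) is a bounded domain and $\epsilon>0$ is a constant. $\mathcal T$ is a quasi-uniform triangulation $\Omega=\cup_{i=1}^N T_i$, and $V_h=\{v\in C^0(\Omega)\cap H^1(\Omega): v|_{T_i}\in P_k\ \forall T_i\in\mathcal T\}$, where $P_k$ is the space of polynomials of degree at most $k$ ($k\ge1$ fixed). $C^0(\Omega)$ denotes functions continuous on $\overline\Omega$. $(\cdot,\cdot)$ and $\|\cdot\|$ are the $L^2(\Omega)$ inner product and norm. $\Pi$ is the $L^2(\Omega)$-orthogonal projection onto $V_h$. For a coefficient $a(x)$, $A(a;q,v)=\int_\Omega a(x)\nabla q\cdot\nabla v\,dx$. The potential $F$ is a $C^1$ function on an interval $I\subseteq\mathbb{R}$ (e.g. $F(u)=\frac14(u^2-1)^2$ with $I=\mathbb{R}$, or the logarithmic Flory–Huggins potential with $I=(0,1)$). The constant $B\ge0$ is such that $F+B>0$, and $H(w)=F'(w)/\sqrt{F(w)+B}$. The mobility $M\ge0$ is a continuous function. It is a standing assumption that all functions at which $F,F',H,M$ are evaluated take values (on $\overline\Omega$) where these are defined and $F+B>0$. $u_0$ is the given initial datum, with $u_0,\sqrt{F(u_0)+B}\in L^2(\Omega)$. The energy is $E(v,V)=\frac12A(\epsilon^2;v,v)+\int_\Omega V^2\,dx-B|\Omega|$. *)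

theory Defs
  imports "HOL-Analysis.Analysis"
begin

section \<open>Lebesgue and Sobolev spaces\<close>

definition L2_space :: "'a::euclidean_space set \<Rightarrow> ('a \<Rightarrow> real) set" where
  "L2_space \<Omega> = {f. f \<in> borel_measurable (lebesgue_on \<Omega>) \<and>
                    integrable (lebesgue_on \<Omega>) (\<lambda>x. (f x)\<^sup>2)}"

definition L2_inner :: "'a::euclidean_space set \<Rightarrow> ('a \<Rightarrow> real) \<Rightarrow> ('a \<Rightarrow> real) \<Rightarrow> real" where
  "L2_inner \<Omega> f g = (LINT x|lebesgue_on \<Omega>. f x * g x)"

definition L2_nrm :: "'a::euclidean_space set \<Rightarrow> ('a \<Rightarrow> real) \<Rightarrow> real" where
  "L2_nrm \<Omega> f = sqrt (L2_inner \<Omega> f f)"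

definition partial_deriv :: "'d::finite \<Rightarrow> (real ^ 'd \<Rightarrow> real) \<Rightarrow> real ^ 'd \<Rightarrow> real" where
  "partial_deriv i f x = frechet_derivative f (at x) (axis i 1)"

primrec C_times :: "nat \<Rightarrow> (real ^ 'd::finite \<Rightarrow> real) \<Rightarrow> bool" where
  "C_times 0 f \<longleftrightarrow> continuous_on UNIV f"
| "C_times (Suc m) f \<longleftrightarrow> (\<forall>x. f differentiable (at x)) \<and> (\<forall>i. C_times m (partial_deriv i f))"

text \<open>Smooth functions with compact support contained in the open set \<open>\<Omega>\<close>.\<close>

definition test_functions :: "(real ^ 'd::finite) set \<Rightarrow> (real ^ 'd \<Rightarrow> real) set" where
  "test_functions \<Omega> = {\<phi>. (\<forall>m. C_times m \<phi>) \<and>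
                          compact (closure {x. \<phi> x \<noteq> 0}) \<and> closure {x. \<phi> x \<noteq> 0} \<subseteq> \<Omega>}"

definition is_weak_gradient ::
  "(real ^ 'd::finite) set \<Rightarrow> (real ^ 'd \<Rightarrow> real) \<Rightarrow> (real ^ 'd \<Rightarrow> real ^ 'd) \<Rightarrow> bool" where
  "is_weak_gradient \<Omega> v g \<longleftrightarrow>
     (\<forall>i. (\<lambda>x. g x $ i) \<in> L2_space \<Omega>) \<and>
     (\<forall>\<phi>\<in>test_functions \<Omega>. \<forall>i.
        (LINT x|lebesgue_on \<Omega>. v x * partial_deriv i \<phi> x) = - (LINT x|lebesgue_on \<Omega>. g x $ i * \<phi> x))"

definition H1_space :: "(real ^ 'd::finite) set \<Rightarrow> (real ^ 'd \<Rightarrow> real) set" where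
  "H1_space \<Omega> = {v \<in> L2_space \<Omega>. \<exists>g. is_weak_gradient \<Omega> v g}"

text \<open>The weak gradient is determined only almost everywhere on \<open>\<Omega>\<close>; an arbitrary
  representative is chosen.\<close>

definition weak_gradient ::
  "(real ^ 'd::finite) set \<Rightarrow> (real ^ 'd \<Rightarrow> real) \<Rightarrow> real ^ 'd \<Rightarrow> real ^ 'd" where
  "weak_gradient \<Omega> v = (SOME g. is_weak_gradient \<Omega> v g)"

section \<open>The finite element space\<close>

text \<open>The simplices of the mesh are closed, so they cover the closure of the (open) domain.
  The library notion \<open>triangulation\<close> makes the mesh finite and conforming.\<close>

definition mesh_of :: "(real ^ 'd::finite) set \<Rightarrow> (real ^ 'd) set set \<Rightarrow> bool" where
  "mesh_of \<Omega> \<T> \<longleftrightarrow>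
     triangulation \<T> \<and> (\<forall>T\<in>\<T>. int CARD('d) simplex T) \<and> closure \<Omega> = \<Union>\<T>"

text \<open>Quasi-uniformity with constant \<open>\<sigma>\<close>: every simplex contains a ball whose radius is at
  least \<open>1 / \<sigma>\<close> times the largest diameter occurring in the mesh.\<close>

definition quasi_uniform :: "real \<Rightarrow> (real ^ 'd::finite) set set \<Rightarrow> bool" where
  "quasi_uniform \<sigma> \<T> \<longleftrightarrow>
     \<sigma> > 0 \<and> (\<forall>S\<in>\<T>. \<forall>T\<in>\<T>. \<exists>c r. cball c r \<subseteq> T \<and> diameter S \<le> \<sigma> * r)"

definition polys_upto :: "nat \<Rightarrow> (real ^ 'd::finite \<Rightarrow> real) set" where
  "polys_upto k = {p. \<exists>c. p = (\<lambda>x. \<Sum>\<alpha> | (\<Sum>i\<in>UNIV. \<alpha> i) \<le> k. c \<alpha> * (\<Prod>i\<in>UNIV. (x $ i) ^ \<alpha> i))}"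

text \<open>A function on \<open>closure \<Omega>\<close> is represented by its extension by zero to the whole space,
  so that equality in the finite element space is equality of functions on \<open>closure \<Omega>\<close>.\<close>

definition fe_space ::
  "(real ^ 'd::finite) set \<Rightarrow> (real ^ 'd) set set \<Rightarrow> nat \<Rightarrow> (real ^ 'd \<Rightarrow> real) set" where
  "fe_space \<Omega> \<T> k = {v. continuous_on (closure \<Omega>) v \<and> v \<in> H1_space \<Omega> \<and>
                        (\<forall>T\<in>\<T>. \<exists>p\<in>polys_upto k. \<forall>x\<in>T. v x = p x) \<and>
                        (\<forall>x. x \<notin> closure \<Omega> \<longrightarrow> v x = 0)}"

definition L2_proj ::
  "(real ^ 'd::finite) set \<Rightarrow> (real ^ 'd \<Rightarrow> real) set \<Rightarrow> (real ^ 'd \<Rightarrow> real) \<Rightarrow> real ^ 'd \<Rightarrow> real" where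
  "L2_proj \<Omega> V f = (THE p. p \<in> V \<and> (\<forall>v\<in>V. L2_inner \<Omega> (\<lambda>x. f x - p x) v = 0))"

section \<open>The scheme\<close>

definition A_form ::
  "(real ^ 'd::finite) set \<Rightarrow> (real ^ 'd \<Rightarrow> real) \<Rightarrow> (real ^ 'd \<Rightarrow> real) \<Rightarrow> (real ^ 'd \<Rightarrow> real) \<Rightarrow> real" where
  "A_form \<Omega> a q v = (LINT x|lebesgue_on \<Omega>. a x * (weak_gradient \<Omega> q x \<bullet> weak_gradient \<Omega> v x))"

definition H_fun :: "(real \<Rightarrow> real) \<Rightarrow> (real \<Rightarrow> real) \<Rightarrow> real \<Rightarrow> real \<Rightarrow> real" where
  "H_fun F F' B s = F' s / sqrt (F s + B)"

definition energy ::
  "(real ^ 'd::finite) set \<Rightarrow> real \<Rightarrow> real \<Rightarrow> (real ^ 'd \<Rightarrow> real) \<Rightarrow> (real ^ 'd \<Rightarrow> real) \<Rightarrow> real" where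
  "energy \<Omega> \<epsilon> B v V =
     1 / 2 * A_form \<Omega> (\<lambda>_. \<epsilon>\<^sup>2) v v + (LINT x|lebesgue_on \<Omega>. (V x)\<^sup>2) - B * measure lebesgue \<Omega>"

text \<open>\<open>I\<close> and \<open>J\<close> are the domains of definition of the potential \<open>F\<close> and of the mobility.\<close>

definition admissible ::
  "(real ^ 'd::finite) set \<Rightarrow> real set \<Rightarrow> real set \<Rightarrow> (real \<Rightarrow> real) \<Rightarrow> real \<Rightarrow> (real ^ 'd \<Rightarrow> real) \<Rightarrow> bool" where
  "admissible \<Omega> I J F B v \<longleftrightarrow> (\<forall>x\<in>closure \<Omega>. v x \<in> I \<and> v x \<in> J \<and> F (v x) + B > 0)"

text \<open>\<open>(u', w', U')\<close> solves the scheme for one time step of size \<open>dt\<close> from \<open>(u, U)\<close> in the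
  finite element space \<open>V\<close>.\<close>

definition scheme_step ::
  "(real ^ 'd::finite) set \<Rightarrow> (real ^ 'd \<Rightarrow> real) set \<Rightarrow> real \<Rightarrow> (real \<Rightarrow> real) \<Rightarrow> (real \<Rightarrow> real) \<Rightarrow>
   real \<Rightarrow> (real \<Rightarrow> real) \<Rightarrow> real \<Rightarrow>
   (real ^ 'd \<Rightarrow> real) \<Rightarrow> (real ^ 'd \<Rightarrow> real) \<Rightarrow>
   (real ^ 'd \<Rightarrow> real) \<Rightarrow> (real ^ 'd \<Rightarrow> real) \<Rightarrow> (real ^ 'd \<Rightarrow> real) \<Rightarrow> bool" where
  "scheme_step \<Omega> V \<epsilon> F F' B M dt u U u' w' U' \<longleftrightarrow>
     u' \<in> V \<and> w' \<in> V \<and> U' \<in> V \<and>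
     (\<forall>\<phi>\<in>V. L2_inner \<Omega> (\<lambda>x. (u' x - u x) / dt) \<phi> = - A_form \<Omega> (\<lambda>x. M (u x)) w' \<phi>) \<and>
     (\<forall>\<psi>\<in>V. L2_inner \<Omega> w' \<psi> =
        A_form \<Omega> (\<lambda>_. \<epsilon>\<^sup>2) u' \<psi> + L2_inner \<Omega> (\<lambda>x. H_fun F F' B (u x) * U' x) \<psi>) \<and>
     (\<forall>\<tau>\<in>V. L2_inner \<Omega> (\<lambda>x. (U' x - U x) / dt) \<tau> =
        1 / 2 * L2_inner \<Omega> (\<lambda>x. H_fun F F' B (u x) * ((u' x - u x) / dt)) \<tau>)"

text \<open>The first \<open>N\<close> steps of the scheme; the nonlinearities are evaluated exactly at the
  iterates \<open>u n\<close> with \<open>n < N\<close>.\<close>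

definition scheme_run ::
  "(real ^ 'd::finite) set \<Rightarrow> (real ^ 'd \<Rightarrow> real) set \<Rightarrow> real \<Rightarrow> real set \<Rightarrow> real set \<Rightarrow>
   (real \<Rightarrow> real) \<Rightarrow> (real \<Rightarrow> real) \<Rightarrow> real \<Rightarrow> (real \<Rightarrow> real) \<Rightarrow> real \<Rightarrow> (real ^ 'd \<Rightarrow> real) \<Rightarrow> nat \<Rightarrow>
   (nat \<Rightarrow> real ^ 'd \<Rightarrow> real) \<Rightarrow> (nat \<Rightarrow> real ^ 'd \<Rightarrow> real) \<Rightarrow> (nat \<Rightarrow> real ^ 'd \<Rightarrow> real) \<Rightarrow> bool" where
  "scheme_run \<Omega> V \<epsilon> I J F F' B M dt u0 N u w U \<longleftrightarrow>
     u 0 = L2_proj \<Omega> V u0 \<and>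
     U 0 = L2_proj \<Omega> V (\<lambda>x. sqrt (F (u0 x) + B)) \<and>
     (\<forall>n<N. admissible \<Omega> I J F B (u n) \<and>
        scheme_step \<Omega> V \<epsilon> F F' B M dt (u n) (U n) (u (Suc n)) (w (Suc n)) (U (Suc n)))"

end

theory Submission
  imports Defs "HOL-Library.Function_Algebras" "HOL-Computational_Algebra.Polynomial"
begin

text \<open>
  Given \<open>(u, U)\<close>, one time step is a square linear system on the finite-dimensional space
  \<open>V \<times> V \<times> V\<close>, so it has exactly one solution as soon as the homogeneous system has only the
  trivial one. Write \<open>D\<close> and \<open>K\<close> for the Dirichlet forms with coefficients \<open>M(u)\<close> and \<open>\<epsilon>\<^sup>2\<close>.
  Testing the homogeneous equations with \<open>w\<close>, \<open>u\<close> and \<open>U\<close> eliminates the coupling term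
  \<open>(H U, u)\<close> and leaves \<open>K(u,u) + 2 \<parallel>U\<parallel>\<^sup>2 = - dt D(w,w)\<close>. The left side is nonnegative and the
  right side nonpositive, so \<open>U = 0\<close> and \<open>D(w,w) = 0\<close>. The latter does not make \<open>w\<close> vanish, as
  \<open>D\<close> ignores constants and the mobility may be zero; but \<open>w\<close> then lies in the kernel of the semidefinite form \<open>D\<close>, hence
  \<open>(u,\<phi>) = - dt D(w,\<phi>) = 0\<close> for all \<open>\<phi>\<close>, so \<open>u = 0\<close>, and the second equation gives \<open>w = 0\<close>.
  The same test functions, with \<open>u' - u\<close> in place of \<open>u\<close> in the inhomogeneous step, give the
  energy law (\<open>sav_scheme.unique_step\<close>, \<open>sav_scheme.energy_law\<close>). Mass is conserved because the
  constant \<open>1\<close> is a test function with vanishing gradient (\<open>scheme_step_mass\<close>).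

  These arguments are algebra, given that the forms are symmetric and bilinear on \<open>V\<close>. For the
  Dirichlet forms this is the analytic core: the weak gradient is an arbitrarily chosen
  representative, and it is additive almost everywhere only because weak gradients are unique almost
  everywhere (\<open>weak_gradient_unique\<close>). Uniqueness is the fundamental lemma of the calculus of
  variations, \<open>AE_zero_if_orthogonal_to_test_functions\<close>: smooth bumps built from
  \<open>exp (- 1 / t)\<close> converge to indicators of boxes, and boxes generate the Borel sets. That the
  constants have weak gradient zero means that a partial derivative of a test function has integral
  zero, which follows from translation invariance of Lebesgue measure.
\<close>

section \<open>Linear variational problems in finite dimension\<close>

text \<open>
  With this instance, spans and independence are available for function spaces, and through the
  product type also for the space of triples of functions.
\<close>

instantiation "fun" :: (type, scaleR) scaleR
begin
definition scaleR_fun :: "real \<Rightarrow> ('a \<Rightarrow> 'b) \<Rightarrow> 'a \<Rightarrow> 'b" where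
  "scaleR_fun c f = (\<lambda>x. c *\<^sub>R f x)"
instance ..
end

instance "fun" :: (type, real_vector) real_vector
  by standard (auto simp: scaleR_fun_def fun_eq_iff scaleR_add_right scaleR_add_left)

lemma scaleR_fun_apply [simp]: "(c *\<^sub>R f) x = c *\<^sub>R f x"
  by (simp add: scaleR_fun_def)

text \<open>
  Linearity is required on \<open>V\<close> only: a form built from chosen weak gradients has no reason to be
  linear outside the Sobolev space.
\<close>

definition linear_functional_on :: "'a::real_vector set \<Rightarrow> ('a \<Rightarrow> real) \<Rightarrow> bool" where
  "linear_functional_on V f \<longleftrightarrow>
     (\<forall>x\<in>V. \<forall>y\<in>V. f (x + y) = f x + f y) \<and> (\<forall>c. \<forall>x\<in>V. f (c *\<^sub>R x) = c * f x)"

lemma linear_functional_onI: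
  assumes "\<And>x y. x \<in> V \<Longrightarrow> y \<in> V \<Longrightarrow> f (x + y) = f x + f y"
    and "\<And>c x. x \<in> V \<Longrightarrow> f (c *\<^sub>R x) = c * f x"
  shows "linear_functional_on V f"
  using assms by (simp add: linear_functional_on_def)

lemma linear_functional_on_0:
  assumes "linear_functional_on V f" "subspace V"
  shows "f 0 = 0"
proof -
  have "f (0 *\<^sub>R 0) = 0 * f 0"
    using assms subspace_0 unfolding linear_functional_on_def by blast
  then show ?thesis by simp
qed

lemma linear_functional_on_diff:
  assumes "linear_functional_on V f" "subspace V" "x \<in> V" "y \<in> V"
  shows "f (x - y) = f x - f y"
proof -
  have "f (x + (-1) *\<^sub>R y) = f x + f ((-1) *\<^sub>R y)"
    using assms subspace_scale unfolding linear_functional_on_def by blast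
  also have "f ((-1) *\<^sub>R y) = - 1 * f y"
    using assms unfolding linear_functional_on_def by blast
  finally show ?thesis by simp
qed

lemma linear_functional_on_eq_span:
  assumes f: "linear_functional_on (span B) f" and g: "linear_functional_on (span B) g"
    and eq: "\<And>b. b \<in> B \<Longrightarrow> f b = g b" and x: "x \<in> span B"
  shows "f x = g x"
proof -
  have sub: "subspace {x \<in> span B. f x = g x}"
    using f g linear_functional_on_0[OF f] linear_functional_on_0[OF g]
    by (auto simp: linear_functional_on_def intro!: subspaceI span_zero span_add span_scale)
  have "span B \<subseteq> {x \<in> span B. f x = g x}"
    by (rule span_minimal) (use eq sub in \<open>auto simp: span_base\<close>)
  then show ?thesis using x by auto
qed

text \<open>
  A vector of \<open>span T\<close> outside \<open>span S\<close> could be adjoined to \<open>S\<close>, giving more than \<open>card T\<close>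
  independent vectors in \<open>span T\<close>.
\<close>

lemma independent_card_ge_spans:
  assumes "finite T" "independent S" "S \<subseteq> span T" "card T \<le> card S"
  shows "span T \<subseteq> span S"
proof (rule ccontr)
  assume "\<not> span T \<subseteq> span S"
  then obtain x where x: "x \<in> span T" "x \<notin> span S" by blast
  have fin: "finite S" using assms independent_span_bound by blast
  have "independent (insert x S)" using x assms by (simp add: independent_insert)
  then have "card (insert x S) \<le> card T"
    using independent_span_bound[OF \<open>finite T\<close>] x assms by blast
  moreover have "x \<notin> S" using x span_base by blast
  ultimately show False using assms fin by simp
qed

lemma finitely_supported_in_span:
  fixes f :: "'a \<Rightarrow> real"
  assumes "finite B" "\<And>b. b \<notin> B \<Longrightarrow> f b = 0"
  shows "f \<in> span ((\<lambda>b x. if x = b then 1 else 0) ` B)"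
proof -
  have "f = (\<Sum>b\<in>B. f b *\<^sub>R (\<lambda>x. if x = b then 1 else 0))"
  proof
    fix x
    have "(\<Sum>b\<in>B. f b *\<^sub>R (\<lambda>x. if x = b then 1 else 0 :: real)) x
      = (\<Sum>b\<in>B. if x = b then f b else 0)"
      by (induction B rule: infinite_finite_induct) (auto simp: scaleR_fun_def)
    also have "\<dots> = f x" using assms by (auto simp: sum.delta)
    finally show "f x = (\<Sum>b\<in>B. f b *\<^sub>R (\<lambda>x. if x = b then 1 else 0)) x" by simp
  qed
  also have "\<dots> \<in> span ((\<lambda>b x. if x = b then 1 else 0) ` B)"
    by (intro span_sum span_scale span_base) auto
  finally show ?thesis .
qed

text \<open>
  Let \<open>B\<close> be a basis of \<open>V\<close>. The map sending \<open>z\<close> to the values \<open>a z b\<close>, \<open>b \<in> B\<close>, is injective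
  on \<open>V\<close> by nondegeneracy and takes values in the functions supported on \<open>B\<close>, which are spanned by
  \<open>card B\<close> vectors. Hence it is onto, and a solution for the test vectors in \<open>B\<close> is one for all
  of \<open>V\<close>.
\<close>

lemma finite_dim_variational_problem:
  fixes a :: "'a::real_vector \<Rightarrow> 'a \<Rightarrow> real"
  assumes V: "subspace V" and fin: "finite C" "V \<subseteq> span C"
    and left: "\<And>y. y \<in> V \<Longrightarrow> linear_functional_on V (\<lambda>z. a z y)"
    and right: "\<And>z. z \<in> V \<Longrightarrow> linear_functional_on V (a z)"
    and nondegenerate: "\<And>z. z \<in> V \<Longrightarrow> (\<And>y. y \<in> V \<Longrightarrow> a z y = 0) \<Longrightarrow> z = 0"
    and l: "linear_functional_on V l"
  shows "\<exists>!z. z \<in> V \<and> (\<forall>y\<in>V. a z y = l y)"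
proof -
  obtain B where B: "B \<subseteq> V" "independent B" "V \<subseteq> span B"
    using maximal_independent_subset[of V] by blast
  have VB: "span B = V"
    using B V span_minimal by blast
  have "finite B" using independent_span_bound fin B by blast
  \<comment> \<open>a total linear map that agrees on \<open>V\<close> with \<open>z \<mapsto> (a z b)\<close>\<close>
  obtain g :: "'a \<Rightarrow> 'a \<Rightarrow> real" where g: "linear g"
    "\<And>z. z \<in> B \<Longrightarrow> g z = (\<lambda>b. if b \<in> B then a z b else 0)"
    using linear_independent_extend[OF B(2), of "\<lambda>z b. if b \<in> B then a z b else 0"] by blast
  have gV: "g z b = (if b \<in> B then a z b else 0)" if z: "z \<in> V" for z b
  proof -
    have 1: "linear_functional_on (span B) (\<lambda>z. g z b)"
      using g(1) by (auto simp: linear_functional_on_def linear_add linear_scale scaleR_fun_def)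
    have 2: "linear_functional_on (span B) (\<lambda>z. if b \<in> B then a z b else 0)"
      using left[of b] B(1) VB by (auto simp: linear_functional_on_def)
    show ?thesis
      using linear_functional_on_eq_span[OF 1 2] g(2) z VB by auto
  qed
  have zero: "linear_functional_on V (\<lambda>_. 0)" by (simp add: linear_functional_on_def)
  have "inj_on g V"
    unfolding linear_injective_on_subspace_0[OF g(1) V]
  proof (intro ballI impI)
    fix z assume z: "z \<in> V" "g z = 0"
    have "a z b = 0" if "b \<in> B" for b
      using gV[OF z(1), of b] z(2) that by simp
    then have "a z y = 0" if "y \<in> V" for y
      using linear_functional_on_eq_span[of B "a z" "\<lambda>_. 0"] right zero z that VB by auto
    then show "z = 0" using nondegenerate z by blast
  qed
  then have indep: "independent (g ` B)" and card: "card (g ` B) = card B"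
    using linear_independent_injective_image[OF g(1) B(2)] VB card_image[OF inj_on_subset[of g V B]] B(1)
    by simp_all
  let ?T = "(\<lambda>b x. if x = b then 1 else 0 :: real) ` B"
  have supp: "f \<in> span ?T" if "\<And>b. b \<notin> B \<Longrightarrow> f b = 0" for f
    using finitely_supported_in_span[OF \<open>finite B\<close>, of f] that by blast
  have "g ` B \<subseteq> span ?T" using g(2) by (auto intro!: supp)
  moreover have "card ?T \<le> card (g ` B)" using card card_image_le[OF \<open>finite B\<close>] by metis
  ultimately have "span ?T \<subseteq> span (g ` B)"
    using independent_card_ge_spans indep \<open>finite B\<close> by blast
  then have "(\<lambda>b. if b \<in> B then l b else 0) \<in> g ` V"
    using supp[of "\<lambda>b. if b \<in> B then l b else 0"] linear_span_image[OF g(1), of B] VB by auto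
  then obtain z where z: "z \<in> V" "g z = (\<lambda>b. if b \<in> B then l b else 0)" by auto
  have "a z b = l b" if "b \<in> B" for b
    using gV[OF z(1), of b] z(2) that by simp
  then have sol: "a z y = l y" if "y \<in> V" for y
    using linear_functional_on_eq_span[of B "a z" l] right l z that VB by auto
  show ?thesis
  proof (intro ex1I[of _ z] conjI ballI)
    fix z' assume z': "z' \<in> V \<and> (\<forall>y\<in>V. a z' y = l y)"
    have "a (z' - z) y = 0" if "y \<in> V" for y
      using linear_functional_on_diff[OF left[OF that] V] z z' sol that by simp
    then have "z' - z = 0" using nondegenerate z z' V subspace_diff by blast
    then show "z' = z" by simp
  qed (use z sol in auto)
qed

lemma Times3_subset_span:
  fixes C :: "'a::real_vector set"
  assumes C: "V \<subseteq> span C"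
  shows "V \<times> V \<times> V \<subseteq>
    span ((\<lambda>x. (x, 0, 0)) ` C \<union> (\<lambda>x. (0, x, 0)) ` C \<union> (\<lambda>x. (0, 0, x)) ` C)" (is "_ \<subseteq> span ?C")
proof clarify
  fix x y z assume mem: "x \<in> V" "y \<in> V" "z \<in> V"
  have embed: "f v \<in> span ?C" if "linear f" "f ` C \<subseteq> ?C" "v \<in> V" for f :: "'a \<Rightarrow> 'a \<times> 'a \<times> 'a" and v
  proof -
    have "f v \<in> f ` span C" using that C by blast
    then have "f v \<in> span (f ` C)" using linear_span_image[OF that(1)] by simp
    then show ?thesis using span_mono[OF that(2)] by blast
  qed
  have "(x, 0, 0) \<in> span ?C"
    by (rule embed[of "\<lambda>x. (x, 0, 0)"]) (use mem in \<open>auto intro!: linearI\<close>)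
  moreover have "(0, y, 0) \<in> span ?C"
    by (rule embed[of "\<lambda>x. (0, x, 0)"]) (use mem in \<open>auto intro!: linearI\<close>)
  moreover have "(0, 0, z) \<in> span ?C"
    by (rule embed[of "\<lambda>x. (0, 0, x)"]) (use mem in \<open>auto intro!: linearI\<close>)
  ultimately have "(x, 0, 0) + ((0, y, 0) + (0, 0, z)) \<in> span ?C" by (intro span_add)
  then show "(x, y, z) \<in> span ?C" by simp
qed

section \<open>The linear algebra of one time step\<close>

definition symmetric_form_on :: "'a::real_vector set \<Rightarrow> ('a \<Rightarrow> 'a \<Rightarrow> real) \<Rightarrow> bool" where
  "symmetric_form_on V a \<longleftrightarrow>
     (\<forall>y\<in>V. linear_functional_on V (\<lambda>x. a x y)) \<and> (\<forall>x\<in>V. \<forall>y\<in>V. a x y = a y x)"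

lemma symmetric_form_on_right:
  "symmetric_form_on V a \<Longrightarrow> subspace V \<Longrightarrow> x \<in> V \<Longrightarrow> linear_functional_on V (a x)"
  unfolding symmetric_form_on_def linear_functional_on_def
  by (metis subspace_add subspace_scale)

lemma symmetric_form_on_arith:
  assumes "symmetric_form_on V a" "subspace V" "x \<in> V" "z \<in> V"
  shows "a (c *\<^sub>R x) z = c * a x z" "a z (c *\<^sub>R x) = c * a z x"
    "y \<in> V \<Longrightarrow> a (x + y) z = a x z + a y z" "y \<in> V \<Longrightarrow> a z (x + y) = a z x + a z y"
    "y \<in> V \<Longrightarrow> a (x - y) z = a x z - a y z" "y \<in> V \<Longrightarrow> a z (x - y) = a z x - a z y"
proof -
  have l: "linear_functional_on V (\<lambda>x. a x z)" using assms by (auto simp: symmetric_form_on_def)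
  have r: "linear_functional_on V (a z)" using symmetric_form_on_right assms by blast
  show "a (c *\<^sub>R x) z = c * a x z" "a z (c *\<^sub>R x) = c * a z x"
    "y \<in> V \<Longrightarrow> a (x + y) z = a x z + a y z" "y \<in> V \<Longrightarrow> a z (x + y) = a z x + a z y"
    "y \<in> V \<Longrightarrow> a (x - y) z = a x z - a y z" "y \<in> V \<Longrightarrow> a z (x - y) = a z x - a z y"
    using l r assms linear_functional_on_diff[OF l] linear_functional_on_diff[OF r]
    unfolding linear_functional_on_def by auto
qed

lemma symmetric_form_on_zero:
  assumes "symmetric_form_on V a" "subspace V" "z \<in> V"
  shows "a 0 z = 0" "a z 0 = 0"
  using symmetric_form_on_arith(1,2)[OF assms(1,2) assms(3) assms(3), of 0] by auto

text \<open>
  If \<open>a x x = 0\<close>, then \<open>a (t x + y) (t x + y) = 2 t a x y + a y y\<close> is affine in \<open>t\<close>, and it can be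
  nonnegative for all \<open>t\<close> only if \<open>a x y = 0\<close>.
\<close>

lemma semidefinite_form_kernel:
  assumes a: "symmetric_form_on V a" and V: "subspace V"
    and nonneg: "\<And>x. x \<in> V \<Longrightarrow> a x x \<ge> 0"
    and x: "x \<in> V" "a x x = 0" and y: "y \<in> V"
  shows "a x y = 0"
proof (rule ccontr)
  assume ne: "a x y \<noteq> 0"
  \<comment> \<open>the value of \<open>t\<close> at which the affine function is \<open>-1\<close>\<close>
  let ?t = "- (a y y + 1) / (2 * a x y)"
  let ?z = "?t *\<^sub>R x + y"
  have tx: "?t *\<^sub>R x \<in> V" using V x subspace_scale by blast
  then have z: "?z \<in> V" using V y subspace_add by blast
  note [simp] = symmetric_form_on_arith[OF a V]
  have "a y x = a x y" using a x y by (auto simp: symmetric_form_on_def)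
  then have "a ?z ?z = 2 * ?t * a x y + a y y"
    using tx x y z by (simp del: scaleR_minus_left)
  also have "\<dots> = - 1" using ne by (simp add: field_simps)
  finally show False using nonneg[OF z] by simp
qed

text \<open>
  The scalar auxiliary variable (SAV) scheme with the function space stripped off: \<open>G\<close> stands for
  the \<open>L\<^sup>2\<close> inner product, \<open>D\<close> for the Dirichlet form weighted by the mobility, \<open>K\<close> for the one
  weighted by \<open>\<epsilon>\<^sup>2\<close>, and \<open>P\<close> for the inner product weighted by \<open>H(u)\<close>, which need not be
  definite. In \<open>step\<close> the two evolution equations are multiplied by \<open>dt\<close>.
\<close>

locale sav_scheme =
  fixes V :: "'a::real_vector set" and G D K P :: "'a \<Rightarrow> 'a \<Rightarrow> real" and dt :: real
  assumes V: "subspace V" and finite_dim: "\<exists>C. finite C \<and> V \<subseteq> span C"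
    and forms: "symmetric_form_on V G" "symmetric_form_on V D"
      "symmetric_form_on V K" "symmetric_form_on V P"
    and G_nonneg: "\<And>x. x \<in> V \<Longrightarrow> G x x \<ge> 0"
    and G_definite: "\<And>x. x \<in> V \<Longrightarrow> G x x = 0 \<Longrightarrow> x = 0"
    and D_nonneg: "\<And>x. x \<in> V \<Longrightarrow> D x x \<ge> 0"
    and K_nonneg: "\<And>x. x \<in> V \<Longrightarrow> K x x \<ge> 0"
    and dt: "dt > 0"
begin

definition step :: "'a \<Rightarrow> 'a \<Rightarrow> 'a \<Rightarrow> 'a \<Rightarrow> 'a \<Rightarrow> bool" where
  "step u U u' w' U' \<longleftrightarrow> u' \<in> V \<and> w' \<in> V \<and> U' \<in> V \<and>
     (\<forall>\<phi>\<in>V. G (u' - u) \<phi> = - dt * D w' \<phi>) \<and>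
     (\<forall>\<psi>\<in>V. G w' \<psi> = K u' \<psi> + P U' \<psi>) \<and>
     (\<forall>\<tau>\<in>V. G (U' - U) \<tau> = 1 / 2 * P (u' - u) \<tau>)"

lemmas form_arith = symmetric_form_on_arith[OF forms(1) V] symmetric_form_on_arith[OF forms(2) V]
  symmetric_form_on_arith[OF forms(3) V] symmetric_form_on_arith[OF forms(4) V]
  symmetric_form_on_zero[OF forms(1) V] symmetric_form_on_zero[OF forms(2) V]
  symmetric_form_on_zero[OF forms(3) V] symmetric_form_on_zero[OF forms(4) V]

lemma form_sym:
  assumes "x \<in> V" "y \<in> V"
  shows "G x y = G y x" "D x y = D y x" "K x y = K y x" "P x y = P y x"
  using forms assms by (auto simp: symmetric_form_on_def)

lemma G_eq_zeroI: "x \<in> V \<Longrightarrow> (\<And>y. y \<in> V \<Longrightarrow> G x y = 0) \<Longrightarrow> x = 0"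
  using G_definite by blast

text \<open>
  Testing with \<open>w\<close>, \<open>u\<close> and \<open>U\<close> gives \<open>K u u + 2 G U U = - dt D w w\<close>, where both sides must
  vanish. As \<open>D\<close> is only semidefinite, \<open>D w w = 0\<close> is used through \<open>semidefinite_form_kernel\<close>,
  which gives \<open>u = 0\<close>; only then does the second equation yield \<open>w = 0\<close>.
\<close>

lemma homogeneous_step:
  assumes "step 0 0 u w U"
  shows "u = 0 \<and> w = 0 \<and> U = 0"
proof -
  have mem: "u \<in> V" "w \<in> V" "U \<in> V"
    and 1: "\<And>\<phi>. \<phi> \<in> V \<Longrightarrow> G u \<phi> = - dt * D w \<phi>"
    and 2: "\<And>\<psi>. \<psi> \<in> V \<Longrightarrow> G w \<psi> = K u \<psi> + P U \<psi>"
    and 3: "\<And>\<tau>. \<tau> \<in> V \<Longrightarrow> G U \<tau> = 1 / 2 * P u \<tau>"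
    using assms by (auto simp: step_def)
  have "K u u + 2 * G U U = - dt * D w w"
    using 1[of w] 2[of u] 3[of U] mem form_sym by simp
  moreover have "K u u \<ge> 0" "G U U \<ge> 0" "dt * D w w \<ge> 0"
    using mem K_nonneg G_nonneg D_nonneg dt by auto
  ultimately have "G U U = 0" "dt * D w w = 0" by linarith+
  then have U: "U = 0" and "D w w = 0" using G_definite mem dt by auto
  then have "D w \<phi> = 0" if "\<phi> \<in> V" for \<phi>
    using semidefinite_form_kernel[OF forms(2) V D_nonneg] mem that by blast
  then have u: "u = 0" using 1 mem G_eq_zeroI by simp
  then have "w = 0" using 2 U mem form_arith G_eq_zeroI by simp
  then show ?thesis using u U by simp
qed

text \<open>
  The three equations are one variational problem on \<open>V \<times> V \<times> V\<close>: their sum, tested with triples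
  of which two entries are zero, returns each of them. Its nondegeneracy is \<open>homogeneous_step\<close>.
\<close>

theorem unique_step:
  assumes u: "u \<in> V" and U: "U \<in> V"
  shows "\<exists>!z. case z of (u', w', U') \<Rightarrow> step u U u' w' U'"
proof -
  define a where "a = (\<lambda>(u', w', U') (\<phi>, \<psi>, \<tau>).
    (G u' \<phi> + dt * D w' \<phi>) + (G w' \<psi> - K u' \<psi> - P U' \<psi>) + (G U' \<tau> - 1 / 2 * P u' \<tau>))"
  define l where "l = (\<lambda>u U (\<phi>, \<psi>::'a, \<tau>). G u \<phi> + (G U \<tau> - 1 / 2 * P u \<tau>))"
  let ?W = "V \<times> V \<times> V"
  have W: "subspace ?W" by (intro subspace_Times V)
  have z: "0 \<in> V" using V subspace_0 by blast
  have test: "(u', w', U') \<in> ?W \<and> (\<forall>y\<in>?W. a (u', w', U') y = l u U y) \<longleftrightarrow> step u U u' w' U'"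
    (is "?lhs = ?rhs") if u: "u \<in> V" and U: "U \<in> V" for u' w' U' u U
  proof
    assume lhs: ?lhs
    then have mem: "u' \<in> V" "w' \<in> V" "U' \<in> V" by auto
    have eq: "a (u', w', U') (\<phi>, \<psi>, \<tau>) = l u U (\<phi>, \<psi>, \<tau>)" if "\<phi> \<in> V" "\<psi> \<in> V" "\<tau> \<in> V" for \<phi> \<psi> \<tau>
      using lhs that by blast
    show ?rhs
      unfolding step_def
    proof (intro conjI ballI mem)
      fix \<phi> assume p: "\<phi> \<in> V"
      show "G (u' - u) \<phi> = - dt * D w' \<phi>"
        using eq[OF p z z] p mem u U by (simp add: a_def l_def form_arith)
      show "G w' \<phi> = K u' \<phi> + P U' \<phi>"
        using eq[OF z p z] p mem u U by (simp add: a_def l_def form_arith)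
      show "G (U' - U) \<phi> = 1 / 2 * P (u' - u) \<phi>"
        using eq[OF z z p] p mem u U by (simp add: a_def l_def form_arith algebra_simps)
    qed
  next
    assume step: ?rhs
    then have mem: "u' \<in> V" "w' \<in> V" "U' \<in> V" by (auto simp: step_def)
    have "a (u', w', U') (\<phi>, \<psi>, \<tau>) = l u U (\<phi>, \<psi>, \<tau>)" if p: "\<phi> \<in> V" "\<psi> \<in> V" "\<tau> \<in> V" for \<phi> \<psi> \<tau>
    proof -
      have "G (u' - u) \<phi> = - dt * D w' \<phi>" "G w' \<psi> = K u' \<psi> + P U' \<psi>"
        "G (U' - U) \<tau> = 1 / 2 * P (u' - u) \<tau>"
        using step p by (auto simp: step_def)
      then show ?thesis
        using p mem u U by (simp add: a_def l_def form_arith algebra_simps)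
    qed
    then show ?lhs using mem by auto
  qed
  obtain C where C: "finite C" "V \<subseteq> span C" using finite_dim by blast
  let ?C = "(\<lambda>x. (x, 0, 0)) ` C \<union> (\<lambda>x. (0, x, 0)) ` C \<union> (\<lambda>x. (0, 0, x)) ` C"
  have "\<exists>!z. z \<in> ?W \<and> (\<forall>y\<in>?W. a z y = l u U y)"
  proof (rule finite_dim_variational_problem[OF W])
    show "finite ?C" using C by simp
    show "?W \<subseteq> span ?C"
      using C(2) by (rule Times3_subset_span)
    fix y assume "y \<in> ?W"
    then show "linear_functional_on ?W (\<lambda>z. a z y)"
      by (auto simp: a_def linear_functional_on_def form_arith algebra_simps)
  next
    fix z assume "z \<in> ?W"
    then show "linear_functional_on ?W (a z)"
      by (auto simp: a_def linear_functional_on_def form_arith algebra_simps)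
  next
    show "linear_functional_on ?W (l u U)"
      using u U by (auto simp: l_def linear_functional_on_def form_arith algebra_simps)
  next
    fix x assume x: "x \<in> ?W" "\<And>y. y \<in> ?W \<Longrightarrow> a x y = 0"
    obtain u' w' U' where [simp]: "x = (u', w', U')" by (cases x)
    have "step 0 0 u' w' U'"
      using x z test[of 0 0 u' w' U'] by (simp add: l_def form_arith split_beta)
    from homogeneous_step[OF this] show "x = 0" by (simp add: zero_prod_def)
  qed
  also have "(\<lambda>z. z \<in> ?W \<and> (\<forall>y\<in>?W. a z y = l u U y)) = (\<lambda>z. case z of (u', w', U') \<Rightarrow> step u U u' w' U')"
  proof
    fix z :: "'a \<times> 'a \<times> 'a"
    obtain u' w' U' where "z = (u', w', U')" by (rule prod_cases3)
    then show "(z \<in> ?W \<and> (\<forall>y\<in>?W. a z y = l u U y)) = (case z of (u', w', U') \<Rightarrow> step u U u' w' U')"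
      by (simp only: prod.case test[OF u U])
  qed
  finally show ?thesis .
qed

text \<open>
  Test with \<open>w'\<close>, \<open>u' - u\<close> and \<open>U'\<close>. The coupling terms \<open>P U' (u' - u)\<close> cancel, and
  \<open>2 a x' (x' - x) = a x' x' - a x x + a (x' - x) (x' - x)\<close> for \<open>a = K\<close> and \<open>a = G\<close> produces the
  differences of the energies together with the numerical dissipation.
\<close>

theorem energy_law:
  assumes u: "u \<in> V" and U: "U \<in> V" and step: "step u U u' w' U'"
  shows "1 / 2 * K u' u' + G U' U' = 1 / 2 * K u u + G U U - G (U' - U) (U' - U)
    - dt * D w' w' - 1 / 2 * K (u' - u) (u' - u)"
proof -
  have mem: "u' \<in> V" "w' \<in> V" "U' \<in> V" "u' - u \<in> V" "U' - U \<in> V"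
    using step u U V subspace_diff by (auto simp: step_def)
  have "G (u' - u) w' = - dt * D w' w'" "G w' (u' - u) = K u' (u' - u) + P U' (u' - u)"
    "G (U' - U) U' = 1 / 2 * P (u' - u) U'"
    using step mem unfolding step_def by blast+
  moreover have "G w' (u' - u) = G (u' - u) w'" "P U' (u' - u) = P (u' - u) U'"
    "K u u' = K u' u" "G U U' = G U' U"
    using mem u U form_sym by auto
  moreover have "K u' (u' - u) = K u' u' - K u' u" "G (U' - U) U' = G U' U' - G U U'"
    "K (u' - u) (u' - u) = K u' u' - K u' u - (K u u' - K u u)"
    "G (U' - U) (U' - U) = G U' U' - G U' U - (G U U' - G U U)"
    using mem u U by (simp_all add: form_arith)
  ultimately show ?thesis by (simp add: field_simps)
qed

end

section \<open>Smooth bump functions on boxes\<close>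

text \<open>
  The functions \<open>p(1/t) exp (- 1/t)\<close>, continued by zero to \<open>t \<le> 0\<close>. Admitting all polynomials
  \<open>p\<close> makes the family closed under differentiation, so that smoothness is an easy induction.
\<close>

definition flat_exp :: "real poly \<Rightarrow> real \<Rightarrow> real" where
  "flat_exp p t = (if t > 0 then poly p (1 / t) * exp (- (1 / t)) else 0)"

lemma poly_exp_tendsto_0: "((\<lambda>s. poly p s * exp (- s)) \<longlongrightarrow> 0) at_top" for p :: "real poly"
proof -
  have "((\<lambda>s. \<Sum>i\<le>degree p. coeff p i * (s ^ i / exp s)) \<longlongrightarrow> (\<Sum>i\<le>degree p. coeff p i * 0)) at_top"
    by (intro tendsto_sum tendsto_mult tendsto_const tendsto_power_div_exp_0)
  moreover have "poly p s * exp (- s) = (\<Sum>i\<le>degree p. coeff p i * (s ^ i / exp s))" for s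
    by (simp add: poly_altdef sum_distrib_right exp_minus divide_inverse mult.assoc)
  ultimately show ?thesis by simp
qed

text \<open>
  Only \<open>t = 0\<close> needs an argument: there the right difference quotient is \<open>s p(s) exp (- s)\<close> with
  \<open>s = 1/t\<close> tending to infinity.
\<close>

lemma flat_exp_has_derivative:
  "(flat_exp p has_real_derivative flat_exp (monom 1 2 * (p - pderiv p)) t) (at t)"
proof -
  consider "t > 0" | "t < 0" | "t = 0" by linarith
  then show ?thesis
  proof cases
    case 1
    have "((\<lambda>t. poly p (1 / t) * exp (- (1 / t))) has_real_derivative
        flat_exp (monom 1 2 * (p - pderiv p)) t) (at t)"
      using 1 by (auto intro!: derivative_eq_intros poly_DERIV[THEN DERIV_chain2]
          simp: flat_exp_def poly_monom power2_eq_square field_simps)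
    then show ?thesis
      by (rule has_field_derivative_transform_within_open[of _ _ _ "{0<..}"])
        (use 1 in \<open>auto simp: flat_exp_def\<close>)
  next
    case 2
    have "((\<lambda>t. 0) has_real_derivative 0) (at t)" by simp
    then have "(flat_exp p has_real_derivative 0) (at t)"
      by (rule has_field_derivative_transform_within_open[of _ _ _ "{..<0}"])
        (use 2 in \<open>auto simp: flat_exp_def\<close>)
    then show ?thesis using 2 by (simp add: flat_exp_def)
  next
    case 3
    have "((\<lambda>h. poly (pCons 0 p) (inverse h) * exp (- inverse h)) \<longlongrightarrow> 0) (at_right 0)"
      by (rule filterlim_compose[OF poly_exp_tendsto_0 filterlim_inverse_at_top_right])
    then have "((\<lambda>h. (flat_exp p (0 + h) - flat_exp p 0) / h) \<longlongrightarrow> 0) (at_right 0)"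
      by (rule Lim_transform_eventually)
        (auto simp: flat_exp_def eventually_at_filter inverse_eq_divide)
    moreover have "((\<lambda>h. (flat_exp p (0 + h) - flat_exp p 0) / h) \<longlongrightarrow> 0) (at_left 0)"
      by (rule Lim_transform_eventually[OF tendsto_const]) (auto simp: flat_exp_def eventually_at_filter)
    ultimately have "((\<lambda>h. (flat_exp p (0 + h) - flat_exp p 0) / h) \<longlongrightarrow> 0) (at 0)"
      by (rule filterlim_split_at[rotated])
    then show ?thesis using 3 by (simp add: DERIV_def flat_exp_def)
  qed
qed

lemma flat_exp_bounds: "0 \<le> flat_exp 1 t" "flat_exp 1 t \<le> 1" "flat_exp 1 t \<noteq> 0 \<longleftrightarrow> t > 0"
  by (auto simp: flat_exp_def)

lemma flat_exp_tendsto_indicator: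
  "(\<lambda>n. flat_exp 1 (real (Suc n) * t)) \<longlonglongrightarrow> (if t > 0 then 1 else 0)"
proof (cases "t > 0")
  case True
  have "(\<lambda>n. exp (- ((1 / t) * inverse (real (Suc n))))) \<longlonglongrightarrow> exp (- ((1 / t) * 0))"
    by (intro tendsto_intros LIMSEQ_inverse_real_of_nat)
  moreover have "flat_exp 1 (real (Suc n) * t) = exp (- ((1 / t) * inverse (real (Suc n))))" for n
    using True by (simp add: flat_exp_def field_simps del: of_nat_Suc)
  ultimately show ?thesis using True by simp
next
  case False
  then have "flat_exp 1 (real (Suc n) * t) = 0" for n
    using flat_exp_bounds(3)[of "real (Suc n) * t"] by (auto simp: zero_less_mult_iff simp del: of_nat_Suc)
  then show ?thesis using False by simp
qed

lemma partial_deriv_eq: "(f has_derivative f') (at x) \<Longrightarrow> partial_deriv i f x = f' (axis i 1)"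
  unfolding partial_deriv_def by (simp add: frechet_derivative_at[symmetric])

lemma C_times_SucI:
  assumes "\<And>x. (f has_derivative f' x) (at x)" "\<And>i. C_times m (\<lambda>x. f' x (axis i 1))"
  shows "C_times (Suc m) f"
proof -
  have "partial_deriv i f = (\<lambda>x. f' x (axis i 1))" for i
    using partial_deriv_eq[OF assms(1)] by auto
  then show ?thesis using assms by (auto simp: differentiable_def)
qed

lemma C_times_SucD:
  assumes "C_times (Suc m) f"
  shows "(f has_derivative frechet_derivative f (at x)) (at x)"
    "C_times m (\<lambda>x. frechet_derivative f (at x) (axis i 1))"
  using assms by (auto simp: frechet_derivative_works partial_deriv_def[abs_def])

text \<open>
  The product rule leaves one factor undifferentiated, so the induction for \<open>C_times_mult\<close> needs
  smoothness of lower order as well.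
\<close>

lemma C_times_lower: "C_times (Suc m) f \<Longrightarrow> C_times m f"
proof (induction m arbitrary: f)
  case 0
  then show ?case
    by (auto simp: continuous_on_eq_continuous_at differentiable_imp_continuous_within)
next
  case (Suc m)
  then show ?case by (metis C_times.simps(2))
qed

lemma C_times_const: "C_times m (\<lambda>x. c)"
proof (induction m arbitrary: c)
  case (Suc m)
  show ?case by (rule C_times_SucI[where f' = "\<lambda>_ _. 0"]) (use Suc in auto)
qed simp

lemma C_times_add: "C_times m f \<Longrightarrow> C_times m g \<Longrightarrow> C_times m (\<lambda>x. f x + g x)"
proof (induction m arbitrary: f g)
  case (Suc m)
  show ?case
    by (rule C_times_SucI[OF has_derivative_add[OF C_times_SucD(1)[OF Suc.prems(1)] C_times_SucD(1)[OF Suc.prems(2)]]])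
      (intro Suc.IH C_times_SucD(2) Suc.prems)
qed (auto intro: continuous_on_add)

lemma C_times_mult: "C_times m f \<Longrightarrow> C_times m g \<Longrightarrow> C_times m (\<lambda>x. f x * g x)"
proof (induction m arbitrary: f g)
  case (Suc m)
  show ?case
    by (rule C_times_SucI[OF has_derivative_mult[OF C_times_SucD(1)[OF Suc.prems(1)] C_times_SucD(1)[OF Suc.prems(2)]]])
      (intro C_times_add Suc.IH C_times_SucD(2) Suc.prems C_times_lower)
qed (auto intro: continuous_on_mult)

lemma C_times_prod: "(\<And>i. i \<in> A \<Longrightarrow> C_times m (f i)) \<Longrightarrow> C_times m (\<lambda>x. \<Prod>i\<in>A. f i x)"
  by (induction A rule: infinite_finite_induct) (auto intro: C_times_mult C_times_const)

lemma C_times_flat_exp_coordinate: "C_times m (\<lambda>x. flat_exp p (c * x $ j + d))"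
proof (induction m arbitrary: p)
  case 0
  have "continuous_on UNIV (flat_exp p)"
    using flat_exp_has_derivative DERIV_isCont continuous_at_imp_continuous_on by blast
  then show ?case
    by (auto intro!: continuous_on_compose2[of UNIV "flat_exp p"] continuous_intros)
next
  case (Suc m)
  let ?q = "monom 1 2 * (p - pderiv p)"
  have "((\<lambda>x. flat_exp p (c * x $ j + d)) has_derivative (\<lambda>h. (c * h $ j) * flat_exp ?q (c * x $ j + d))) (at x)" for x
  proof -
    have "((\<lambda>x. c * x $ j + d) has_derivative (\<lambda>h. c * h $ j)) (at x)"
      by (auto intro!: derivative_eq_intros bounded_linear.has_derivative[OF bounded_linear_vec_nth])
    from has_derivative_compose[OF this flat_exp_has_derivative[unfolded has_field_derivative_def]]
    show ?thesis by (simp add: mult.commute)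
  qed
  then show ?case
    by (rule C_times_SucI) (intro C_times_mult C_times_const Suc.IH)
qed

text \<open>
  The factor \<open>Suc n\<close> steepens the flanks, so that the bumps converge pointwise to the indicator of
  the open box; each of them is positive exactly on that box.
\<close>

definition box_bump :: "real ^ 'd::finite \<Rightarrow> real ^ 'd \<Rightarrow> nat \<Rightarrow> real ^ 'd \<Rightarrow> real" where
  "box_bump a b n x =
    (\<Prod>i\<in>UNIV. flat_exp 1 (real (Suc n) * (x $ i - a $ i)) * flat_exp 1 (real (Suc n) * (b $ i - x $ i)))"

lemma box_bump_nonzero: "box_bump a b n x \<noteq> 0 \<longleftrightarrow> x \<in> box a b"
proof -
  have "flat_exp 1 (real (Suc n) * t) = 0 \<longleftrightarrow> \<not> t > 0" for t
    using flat_exp_bounds(3)[of "real (Suc n) * t"] by (auto simp: zero_less_mult_iff simp del: of_nat_Suc)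
  then show ?thesis by (auto simp: box_bump_def mem_box_cart simp del: of_nat_Suc)
qed

lemma box_bump_test_function:
  assumes "cbox a b \<subseteq> \<Omega>"
  shows "box_bump a b n \<in> test_functions \<Omega>"
proof -
  have "C_times m (box_bump a b n)" for m
  proof -
    have "C_times m (\<lambda>x. \<Prod>i\<in>UNIV. flat_exp 1 (real (Suc n) * x $ i + - (real (Suc n) * a $ i))
        * flat_exp 1 (- real (Suc n) * x $ i + real (Suc n) * b $ i))"
      by (intro C_times_prod C_times_mult C_times_flat_exp_coordinate)
    also have "(\<lambda>x. \<Prod>i\<in>UNIV. flat_exp 1 (real (Suc n) * x $ i + - (real (Suc n) * a $ i))
        * flat_exp 1 (- real (Suc n) * x $ i + real (Suc n) * b $ i)) = box_bump a b n"
      by (auto simp: box_bump_def fun_eq_iff algebra_simps)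
    finally show ?thesis .
  qed
  moreover have "closure {x. box_bump a b n x \<noteq> 0} \<subseteq> cbox a b"
    unfolding box_bump_nonzero Collect_mem_eq by (intro closure_minimal box_subset_cbox closed_cbox)
  ultimately show ?thesis
    using assms closed_Int_compact[OF closed_closure compact_cbox, of "{x. box_bump a b n x \<noteq> 0}" a b]
    unfolding test_functions_def by (simp add: Int_absorb2)
qed

lemma box_bump_le_1: "\<bar>box_bump a b n x\<bar> \<le> 1"
proof -
  have "\<bar>box_bump a b n x\<bar> \<le> (\<Prod>i\<in>(UNIV::'a set). 1)"
    unfolding box_bump_def abs_prod
    by (intro prod_mono) (auto simp: abs_mult flat_exp_bounds intro!: mult_le_one)
  then show ?thesis by simp
qed

lemma box_bump_tendsto: "(\<lambda>n. box_bump a b n x) \<longlonglongrightarrow> indicator (box a b) x"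
proof -
  have "(\<lambda>n. box_bump a b n x) \<longlonglongrightarrow>
      (\<Prod>i\<in>UNIV. (if x $ i - a $ i > 0 then 1 else 0) * (if b $ i - x $ i > 0 then 1 else 0))"
    unfolding box_bump_def by (intro tendsto_prod tendsto_mult flat_exp_tendsto_indicator)
  also have "(\<Prod>i\<in>UNIV. (if x $ i - a $ i > 0 then 1 else 0) * (if b $ i - x $ i > 0 then 1 else 0 :: real))
      = indicator (box a b) x"
    by (auto simp: indicator_def mem_box_cart prod_eq_1_iff intro!: prod.neutral)
  finally show ?thesis .
qed

section \<open>Square-integrable functions\<close>

lemma L2_space_mult_integrable:
  assumes "f \<in> L2_space \<Omega>" "g \<in> L2_space \<Omega>"
  shows "integrable (lebesgue_on \<Omega>) (\<lambda>x. f x * g x)"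
proof (rule Bochner_Integration.integrable_bound[of _ "\<lambda>x. (f x)\<^sup>2 + (g x)\<^sup>2"])
  have [measurable]: "f \<in> borel_measurable (lebesgue_on \<Omega>)" "g \<in> borel_measurable (lebesgue_on \<Omega>)"
    using assms by (auto simp: L2_space_def)
  show "integrable (lebesgue_on \<Omega>) (\<lambda>x. (f x)\<^sup>2 + (g x)\<^sup>2)"
    using assms by (auto simp: L2_space_def)
  show "(\<lambda>x. f x * g x) \<in> borel_measurable (lebesgue_on \<Omega>)" by measurable
  have "\<bar>a * b\<bar> \<le> a\<^sup>2 + b\<^sup>2" for a b :: real
  proof -
    have "0 \<le> (\<bar>a\<bar> - \<bar>b\<bar>)\<^sup>2" "0 \<le> \<bar>a\<bar> * \<bar>b\<bar>" by auto
    then have "\<bar>a\<bar> * \<bar>b\<bar> \<le> a\<^sup>2 + b\<^sup>2" unfolding power2_diff power2_abs by linarith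
    then show ?thesis by (simp add: abs_mult)
  qed
  then show "AE x in lebesgue_on \<Omega>. norm (f x * g x) \<le> norm ((f x)\<^sup>2 + (g x)\<^sup>2)"
    by auto
qed

lemma L2_space_lincomb:
  assumes "f \<in> L2_space \<Omega>" "g \<in> L2_space \<Omega>"
  shows "(\<lambda>x. a * f x + b * g x) \<in> L2_space \<Omega>"
proof -
  have [measurable]: "f \<in> borel_measurable (lebesgue_on \<Omega>)" "g \<in> borel_measurable (lebesgue_on \<Omega>)"
    using assms by (auto simp: L2_space_def)
  have "integrable (lebesgue_on \<Omega>) (\<lambda>x. a\<^sup>2 * (f x)\<^sup>2 + b\<^sup>2 * (g x)\<^sup>2 + 2 * a * b * (f x * g x))"
    using assms L2_space_mult_integrable[OF assms] by (auto simp: L2_space_def)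
  also have "(\<lambda>x. a\<^sup>2 * (f x)\<^sup>2 + b\<^sup>2 * (g x)\<^sup>2 + 2 * a * b * (f x * g x)) = (\<lambda>x. (a * f x + b * g x)\<^sup>2)"
    by (auto simp: power2_eq_square algebra_simps)
  finally show ?thesis by (auto simp: L2_space_def)
qed

lemma bounded_measurable_L2_space:
  assumes "\<Omega> \<in> lmeasurable" "f \<in> borel_measurable (lebesgue_on \<Omega>)" "\<And>x. x \<in> \<Omega> \<Longrightarrow> \<bar>f x\<bar> \<le> C"
  shows "f \<in> L2_space \<Omega>"
proof -
  interpret finite_measure "lebesgue_on \<Omega>" using assms(1) by (rule finite_measure_lebesgue_on)
  have [measurable]: "f \<in> borel_measurable (lebesgue_on \<Omega>)" by fact
  have "AE x in lebesgue_on \<Omega>. norm ((f x)\<^sup>2) \<le> C\<^sup>2"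
    using assms(3) by (auto intro!: AE_I2 abs_le_square_iff[THEN iffD1] order_trans[OF _ abs_ge_self])
  then show ?thesis
    unfolding L2_space_def using assms(2) by (auto intro!: integrable_const_bound)
qed

lemma bounded_coefficient_integrable:
  fixes f :: "'a::euclidean_space \<Rightarrow> real"
  assumes "integrable (lebesgue_on \<Omega>) f" "a \<in> borel_measurable (lebesgue_on \<Omega>)"
    "\<And>x. x \<in> \<Omega> \<Longrightarrow> \<bar>a x\<bar> \<le> C"
  shows "integrable (lebesgue_on \<Omega>) (\<lambda>x. a x * f x)"
proof (rule Bochner_Integration.integrable_bound[of _ "\<lambda>x. C * f x"])
  have [measurable]: "f \<in> borel_measurable (lebesgue_on \<Omega>)" "a \<in> borel_measurable (lebesgue_on \<Omega>)"
    using assms by auto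
  show "integrable (lebesgue_on \<Omega>) (\<lambda>x. C * f x)" using assms by auto
  show "(\<lambda>x. a x * f x) \<in> borel_measurable (lebesgue_on \<Omega>)" by measurable
  show "AE x in lebesgue_on \<Omega>. norm (a x * f x) \<le> norm (C * f x)"
    by (intro AE_I2) (auto simp: abs_mult intro!: mult_right_mono order_trans[OF assms(3) abs_ge_self])
qed

lemma continuous_bounded_measurable:
  fixes f :: "'a::euclidean_space \<Rightarrow> real"
  assumes "bounded \<Omega>" "open \<Omega>" "continuous_on (closure \<Omega>) f"
  shows "f \<in> borel_measurable (lebesgue_on \<Omega>)" "\<exists>C. \<forall>x\<in>\<Omega>. \<bar>f x\<bar> \<le> C" "f \<in> L2_space \<Omega>"
proof -
  have om: "\<Omega> \<in> lmeasurable" using assms lmeasurable_open by blast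
  show m: "f \<in> borel_measurable (lebesgue_on \<Omega>)"
    using assms continuous_on_subset[OF assms(3) closure_subset]
    by (intro continuous_imp_measurable_on_sets_lebesgue) auto
  have "bounded (f ` closure \<Omega>)"
    using assms by (intro compact_imp_bounded compact_continuous_image) auto
  then obtain C where C: "\<forall>y\<in>f ` closure \<Omega>. norm y \<le> C" unfolding bounded_iff by blast
  have b: "\<bar>f x\<bar> \<le> C" if "x \<in> \<Omega>" for x
    using C that closure_subset by fastforce
  then show "\<exists>C. \<forall>x\<in>\<Omega>. \<bar>f x\<bar> \<le> C" by blast
  show "f \<in> L2_space \<Omega>" by (rule bounded_measurable_L2_space[OF om m b])
qed

section \<open>The fundamental lemma of the calculus of variations\<close>

text \<open>
  The sets over which \<open>g\<close> has integral zero form a Dynkin system. Boxes are stable under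
  intersection and generate the Borel sets, and a Lebesgue set is a Borel set up to a null set.
\<close>

lemma set_lebesgue_integral_zero_if_boxes:
  fixes g :: "'a::euclidean_space \<Rightarrow> real"
  assumes g: "integrable lebesgue g"
    and box: "\<And>a b. (LINT x:box a b|lebesgue. g x) = 0" and UNIV: "integral\<^sup>L lebesgue g = 0"
    and A: "A \<in> sets lebesgue"
  shows "(LINT x:A|lebesgue. g x) = 0"
proof -
  have int: "set_integrable lebesgue A g" if "A \<in> sets lebesgue" for A
    using g that unfolding set_integrable_def by (intro integrable_mult_indicator)
  have borel: "(LINT x:S|lebesgue. g x) = 0" if S: "S \<in> sets borel" for S :: "'a set"
  proof -
    have S': "S \<in> sigma_sets UNIV (range (\<lambda>(a, b). box a b))"
      using S unfolding borel_eq_box by simp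
    have st: "Int_stable (range (\<lambda>(a, b). box a b :: 'a set))"
      by (auto simp: Int_stable_def box_Int_box)
    have sub: "range (\<lambda>(a, b). box a b) \<subseteq> Pow (UNIV :: 'a set)" by auto
    have leb: "T \<in> sets lebesgue" if "T \<in> sigma_sets UNIV (range (\<lambda>(a, b). box a b))" for T :: "'a set"
      using that borel_eq_box by (metis sets_measure_of subset_UNIV Pow_UNIV sets_completionI_sets sets_lborel)
    from st sub S' show ?thesis
    proof (induction rule: sigma_sets_induct_disjoint)
      case (basic A)
      then show ?case using box by auto
    next
      case empty
      show ?case by (simp add: set_lebesgue_integral_def)
    next
      case (compl A)
      have "(LINT x:(UNIV - A) \<union> A|lebesgue. g x) = (LINT x:(UNIV - A)|lebesgue. g x) + (LINT x:A|lebesgue. g x)"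
        using leb[OF compl(1)] by (intro set_integral_Un int) auto
      moreover have "(UNIV - A) \<union> A = UNIV" by auto
      ultimately show ?case using compl UNIV by (simp add: set_lebesgue_integral_def)
    next
      case (union A)
      have "A i \<in> sigma_sets UNIV (range (\<lambda>(a, b). box a b))" for i
        using union(2) by auto
      then have "A i \<in> sets lebesgue" for i by (rule leb)
      then have "(LINT x:(\<Union>i. A i)|lebesgue. g x) = (\<Sum>i. LINT x:A i|lebesgue. g x)"
        using union(1)
        by (intro lebesgue_integral_countable_add int) (auto simp: disjoint_family_on_def)
      then show ?case using union by simp
    qed
  qed
  from A obtain S N N' where S: "A = S \<union> N" "N \<subseteq> N'" "N' \<in> null_sets lborel" "S \<in> sets lborel"
    by (rule sets_completionE)
  have "N' \<in> null_sets lebesgue" using S(3) by (rule null_sets_completionI)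
  then have "AE x in lebesgue. x \<notin> N'" by (rule AE_not_in)
  then have "AE x in lebesgue. x \<in> A \<longleftrightarrow> x \<in> S" using S by (auto elim: AE_mp)
  then have "(LINT x:A|lebesgue. g x) = (LINT x:S|lebesgue. g x)"
    using A S(4) g unfolding set_lebesgue_integral_def
    by (intro integral_cong_AE borel_measurable_scaleR borel_measurable_indicator)
      (auto simp: indicator_def elim: AE_mp)
  then show ?thesis using borel S by simp
qed

lemma sigma_finite_lebesgue: "sigma_finite_measure (lebesgue :: 'a::euclidean_space measure)"
proof
  let ?A = "range (\<lambda>n. cball (0 :: 'a) (real n))"
  have "\<Union>?A = space lebesgue" using real_arch_simple by auto
  moreover have "emeasure lebesgue a \<noteq> \<infinity>" if "a \<in> ?A" for a
    using that lmeasurable_cball fmeasurableD2 by fastforce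
  ultimately show "\<exists>A. countable A \<and> A \<subseteq> sets (lebesgue :: 'a measure) \<and> \<Union>A = space lebesgue \<and>
      (\<forall>a\<in>A. emeasure lebesgue a \<noteq> \<infinity>)"
    by (intro exI[of _ ?A]) (auto simp del: emeasure_completion)
qed

lemma integral_lebesgue_on:
  fixes f :: "'a::euclidean_space \<Rightarrow> real"
  assumes "S \<in> sets lebesgue"
  shows "(LINT x|lebesgue_on S. f x) = (LINT x|lebesgue. indicator S x * f x)"
  using integral_restrict_space[of S lebesgue f] assms by simp

text \<open>
  By dominated convergence along \<open>box_bump\<close>, \<open>f\<close> has integral zero over every box whose closure
  lies in \<open>\<Omega>\<close>. Cutting \<open>f\<close> off to one such box gives a function whose integral over every box
  is zero, hence over every measurable set, so it vanishes almost everywhere. Countably many closed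
  boxes cover \<open>\<Omega>\<close>, and their boundaries are negligible.
\<close>

lemma AE_zero_if_orthogonal_to_test_functions:
  fixes \<Omega> :: "(real ^ 'd::finite) set"
  assumes \<Omega>: "open \<Omega>" and f: "integrable (lebesgue_on \<Omega>) f"
    and orth: "\<And>\<phi>. \<phi> \<in> test_functions \<Omega> \<Longrightarrow> (LINT x|lebesgue_on \<Omega>. f x * \<phi> x) = 0"
  shows "AE x in lebesgue_on \<Omega>. f x = 0"
proof -
  have leb: "\<Omega> \<in> sets lebesgue" using \<Omega> by auto
  have f': "integrable lebesgue (\<lambda>x. indicator \<Omega> x * f x)"
    using f leb integrable_restrict_space[of \<Omega> lebesgue f] by simp
  have box: "(LINT x|lebesgue. indicator (box a b) x * (indicator \<Omega> x * f x)) = 0"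
    if ab: "cbox a b \<subseteq> \<Omega>" for a b
  proof -
    have lim: "(\<lambda>n. LINT x|lebesgue_on \<Omega>. f x * box_bump a b n x)
        \<longlonglongrightarrow> (LINT x|lebesgue_on \<Omega>. f x * indicator (box a b) x)"
    proof (rule integral_dominated_convergence[where w = "\<lambda>x. \<bar>f x\<bar>"])
      have [measurable]: "f \<in> borel_measurable (lebesgue_on \<Omega>)" using f by auto
      have [measurable]: "box_bump a b n \<in> borel_measurable (lebesgue_on \<Omega>)" for n
      proof -
        have "C_times 0 (box_bump a b n)"
          using box_bump_test_function[OF ab] unfolding test_functions_def by blast
        then show ?thesis
          using leb by (auto intro!: continuous_imp_measurable_on_sets_lebesgue intro: continuous_on_subset)
      qed
      show "(\<lambda>x. f x * box_bump a b n x) \<in> borel_measurable (lebesgue_on \<Omega>)" for n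
        by measurable
      have "indicator (box a b) \<in> borel_measurable (lebesgue_on \<Omega> :: (real ^ 'd) measure)"
        by (rule measurable_restrict_space1, rule borel_measurable_indicator) auto
      then show "(\<lambda>x. f x * indicator (box a b) x) \<in> borel_measurable (lebesgue_on \<Omega>)"
        by measurable
      show "integrable (lebesgue_on \<Omega>) (\<lambda>x. \<bar>f x\<bar>)" using f by auto
      show "AE x in lebesgue_on \<Omega>. (\<lambda>n. f x * box_bump a b n x) \<longlonglongrightarrow> f x * indicator (box a b) x"
        by (intro AE_I2 tendsto_mult tendsto_const box_bump_tendsto)
      show "AE x in lebesgue_on \<Omega>. norm (f x * box_bump a b n x) \<le> \<bar>f x\<bar>" for n
        by (intro AE_I2) (simp add: abs_mult mult_left_le box_bump_le_1)
    qed
    have "(LINT x|lebesgue_on \<Omega>. f x * indicator (box a b) x) = 0"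
      using lim orth[OF box_bump_test_function[OF ab]] by (simp add: LIMSEQ_const_iff)
    then show ?thesis
      unfolding integral_lebesgue_on[OF leb] by (simp add: mult.commute mult.left_commute)
  qed
  have cell: "AE x in lebesgue. x \<in> cbox c d \<longrightarrow> f x = 0" if cd: "cbox c d \<subseteq> \<Omega>" for c d
  proof -
    let ?g = "\<lambda>x. indicator (box c d) x * (indicator \<Omega> x * f x)"
    have g: "integrable lebesgue ?g"
      using integrable_mult_indicator[OF _ f', of "box c d"] by simp
    have "AE x in lebesgue. ?g x = 0"
    proof (rule sigma_finite_measure.density_zero[OF sigma_finite_lebesgue g set_lebesgue_integral_zero_if_boxes[OF g]])
      show "integral\<^sup>L lebesgue ?g = 0" using box[OF cd] .
      fix a b
      \<comment> \<open>the corners of \<open>box a b \<inter> box c d\<close>\<close>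
      define a' :: "real ^ 'd" where "a' = (\<chi> i. max (a $ i) (c $ i))"
      define b' :: "real ^ 'd" where "b' = (\<chi> i. min (b $ i) (d $ i))"
      have "cbox a' b' \<subseteq> cbox c d"
        by (auto simp: mem_box_cart a'_def b'_def)
      then have "(LINT x|lebesgue. indicator (box a' b') x * (indicator \<Omega> x * f x)) = 0"
        using box cd by blast
      moreover have "indicator (box a' b') x = (indicator (box a b) x * indicator (box c d) x :: real)" for x
        by (auto simp: indicator_def mem_box_cart a'_def b'_def)
      ultimately show "(LINT x:box a b|lebesgue. ?g x) = 0"
        by (simp add: set_lebesgue_integral_def mult.assoc)
    qed
    moreover have "AE x in lebesgue. x \<notin> cbox c d - box c d"
      using negligible_frontier_interval negligible_iff_null_sets by (blast intro: AE_not_in)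
    ultimately show ?thesis
      by eventually_elim (use cd in \<open>auto simp: indicator_def\<close>)
  qed
  obtain \<D> where D: "countable \<D>" "\<D> \<subseteq> Pow \<Omega>" "\<And>X. X \<in> \<D> \<Longrightarrow> \<exists>a b. X = cbox a b" "\<Union>\<D> = \<Omega>"
    using open_countable_Union_open_cbox[OF \<Omega>] by blast
  have cells: "AE x in lebesgue. x \<in> X \<longrightarrow> f x = 0" if "X \<in> \<D>" for X
  proof -
    obtain a b where "X = cbox a b" using D(3) \<open>X \<in> \<D>\<close> by blast
    moreover have "X \<subseteq> \<Omega>" using D(2) \<open>X \<in> \<D>\<close> by blast
    ultimately show ?thesis using cell[of a b] by blast
  qed
  have "AE x in lebesgue. \<forall>X\<in>\<D>. x \<in> X \<longrightarrow> f x = 0"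
    by (subst AE_ball_countable[OF D(1)]) (intro ballI cells)
  then have "AE x in lebesgue. x \<in> \<Omega> \<longrightarrow> f x = 0"
    by eventually_elim (use D(4) in blast)
  moreover have "(AE x in lebesgue_on \<Omega>. f x = 0) \<longleftrightarrow> (AE x in lebesgue. x \<in> \<Omega> \<longrightarrow> f x = 0)"
    by (rule AE_restrict_space_iff) (use leb in simp)
  ultimately show ?thesis by blast
qed

section \<open>Weak gradients\<close>

lemma test_function_continuous:
  assumes "\<phi> \<in> test_functions \<Omega>"
  shows "continuous_on S \<phi>" "continuous_on S (partial_deriv i \<phi>)"
proof -
  have "C_times 0 \<phi>" "C_times (Suc 0) \<phi>" using assms unfolding test_functions_def by blast+
  then show "continuous_on S \<phi>" "continuous_on S (partial_deriv i \<phi>)"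
    by (auto intro: continuous_on_subset[OF _ subset_UNIV])
qed

lemma test_function_L2:
  assumes "bounded \<Omega>" "open \<Omega>" "\<phi> \<in> test_functions \<Omega>"
  shows "\<phi> \<in> L2_space \<Omega>" "partial_deriv i \<phi> \<in> L2_space \<Omega>"
  using assms by (auto intro!: continuous_bounded_measurable(3) test_function_continuous)

lemma weak_gradient_by_parts:
  assumes "is_weak_gradient \<Omega> v g" "\<phi> \<in> test_functions \<Omega>"
  shows "(LINT x|lebesgue_on \<Omega>. v x * partial_deriv i \<phi> x) = - (LINT x|lebesgue_on \<Omega>. g x $ i * \<phi> x)"
  using assms unfolding is_weak_gradient_def by blast

lemma weak_gradient_unique:
  assumes \<Omega>: "bounded \<Omega>" "open \<Omega>" and g: "is_weak_gradient \<Omega> v g" and h: "is_weak_gradient \<Omega> v h"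
  shows "AE x in lebesgue_on \<Omega>. g x = h x"
proof -
  have "AE x in lebesgue_on \<Omega>. g x $ i - h x $ i = 0" for i
  proof (rule AE_zero_if_orthogonal_to_test_functions[OF \<Omega>(2)])
    have L2: "(\<lambda>x. g x $ i) \<in> L2_space \<Omega>" "(\<lambda>x. h x $ i) \<in> L2_space \<Omega>"
      using g h by (auto simp: is_weak_gradient_def)
    have one: "(\<lambda>_. 1) \<in> L2_space \<Omega>"
      using \<Omega> by (auto intro: continuous_bounded_measurable(3))
    show "integrable (lebesgue_on \<Omega>) (\<lambda>x. g x $ i - h x $ i)"
      using L2_space_mult_integrable[OF L2(1) one] L2_space_mult_integrable[OF L2(2) one] by simp
    fix \<phi> assume \<phi>: "\<phi> \<in> test_functions \<Omega>"
    note L2_space_mult_integrable[OF L2(1) test_function_L2(1)[OF \<Omega> \<phi>]]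
      L2_space_mult_integrable[OF L2(2) test_function_L2(1)[OF \<Omega> \<phi>]]
    then have "(LINT x|lebesgue_on \<Omega>. (g x $ i - h x $ i) * \<phi> x)
        = (LINT x|lebesgue_on \<Omega>. g x $ i * \<phi> x) - (LINT x|lebesgue_on \<Omega>. h x $ i * \<phi> x)"
      by (simp add: left_diff_distrib)
    also have "\<dots> = 0"
      using weak_gradient_by_parts[OF g \<phi>, of i] weak_gradient_by_parts[OF h \<phi>, of i] by linarith
    finally show "(LINT x|lebesgue_on \<Omega>. (g x $ i - h x $ i) * \<phi> x) = 0" .
  qed
  then have "AE x in lebesgue_on \<Omega>. \<forall>i\<in>UNIV. g x $ i - h x $ i = 0"
    by (intro AE_finite_allI) auto
  then show ?thesis by eventually_elim (simp add: vec_eq_iff)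
qed

lemma is_weak_gradient_lincomb:
  assumes \<Omega>: "bounded \<Omega>" "open \<Omega>" and v: "v \<in> L2_space \<Omega>" "is_weak_gradient \<Omega> v g"
    and w: "w \<in> L2_space \<Omega>" "is_weak_gradient \<Omega> w h"
  shows "is_weak_gradient \<Omega> (\<lambda>x. a * v x + b * w x) (\<lambda>x. a *\<^sub>R g x + b *\<^sub>R h x)"
  unfolding is_weak_gradient_def
proof (intro conjI ballI allI)
  fix i
  have L2: "(\<lambda>x. g x $ i) \<in> L2_space \<Omega>" "(\<lambda>x. h x $ i) \<in> L2_space \<Omega>"
    using v w by (auto simp: is_weak_gradient_def)
  then show "(\<lambda>x. (a *\<^sub>R g x + b *\<^sub>R h x) $ i) \<in> L2_space \<Omega>"
    by (simp add: L2_space_lincomb)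
  fix \<phi> assume \<phi>: "\<phi> \<in> test_functions \<Omega>"
  note int = test_function_L2[OF \<Omega> \<phi>, THEN L2_space_mult_integrable[rotated]]
  have "(LINT x|lebesgue_on \<Omega>. (a * v x + b * w x) * partial_deriv i \<phi> x)
      = a * (LINT x|lebesgue_on \<Omega>. v x * partial_deriv i \<phi> x)
        + b * (LINT x|lebesgue_on \<Omega>. w x * partial_deriv i \<phi> x)"
    using int(2)[OF v(1)] int(2)[OF w(1)] by (simp add: distrib_right mult.assoc)
  also have "\<dots> = - (a * (LINT x|lebesgue_on \<Omega>. g x $ i * \<phi> x) + b * (LINT x|lebesgue_on \<Omega>. h x $ i * \<phi> x))"
    unfolding weak_gradient_by_parts[OF v(2) \<phi>] weak_gradient_by_parts[OF w(2) \<phi>] by simp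
  also have "a * (LINT x|lebesgue_on \<Omega>. g x $ i * \<phi> x) + b * (LINT x|lebesgue_on \<Omega>. h x $ i * \<phi> x)
      = (LINT x|lebesgue_on \<Omega>. (a *\<^sub>R g x + b *\<^sub>R h x) $ i * \<phi> x)"
    using int(1)[OF L2(1)] int(1)[OF L2(2)] by (simp add: distrib_right mult.assoc)
  finally show "(LINT x|lebesgue_on \<Omega>. (a * v x + b * w x) * partial_deriv i \<phi> x)
      = - (LINT x|lebesgue_on \<Omega>. (a *\<^sub>R g x + b *\<^sub>R h x) $ i * \<phi> x)" .
qed

text \<open>
  By translation invariance every difference quotient of \<open>\<phi>\<close> in a coordinate direction has integral
  zero. The quotients are bounded by the mean value theorem and are supported in a fixed ball, so
  dominated convergence passes to the derivative.
\<close>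

lemma integral_partial_deriv_eq_zero:
  fixes \<phi> :: "real ^ 'd::finite \<Rightarrow> real"
  assumes diff: "\<And>x. \<phi> differentiable (at x)" and cont: "continuous_on UNIV (partial_deriv i \<phi>)"
    and K: "compact K" "\<And>x. x \<notin> K \<Longrightarrow> \<phi> x = 0"
  shows "(LINT x|lborel. partial_deriv i \<phi> x) = 0"
proof -
  let ?e = "axis i 1 :: real ^ 'd" and ?D = "partial_deriv i \<phi>"
  have line: "((\<lambda>s. \<phi> (x + s *\<^sub>R ?e)) has_real_derivative ?D (x + s *\<^sub>R ?e)) (at s)" for x s
  proof -
    have "((\<lambda>s. x + s *\<^sub>R ?e) has_derivative (\<lambda>h. h *\<^sub>R ?e)) (at s)"
      by (auto intro!: derivative_eq_intros)
    moreover have "(\<phi> has_derivative frechet_derivative \<phi> (at (x + s *\<^sub>R ?e))) (at (x + s *\<^sub>R ?e))"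
      using diff frechet_derivative_works by blast
    ultimately have "((\<lambda>s. \<phi> (x + s *\<^sub>R ?e)) has_derivative
        (\<lambda>h. frechet_derivative \<phi> (at (x + s *\<^sub>R ?e)) (h *\<^sub>R ?e))) (at s)"
      by (rule has_derivative_compose)
    moreover have "linear (frechet_derivative \<phi> (at (x + s *\<^sub>R ?e)))"
      using diff linear_frechet_derivative by blast
    ultimately show ?thesis
      by (simp add: has_field_derivative_def linear_scale partial_deriv_def mult.commute[of _ "frechet_derivative _ _ _"])
  qed
  have c\<phi>: "continuous_on UNIV \<phi>"
    using diff by (auto simp: continuous_on_eq_continuous_at differentiable_imp_continuous_within)
  have D0: "?D x = 0" if "x \<notin> K" for x
  proof -
    have "open (- K)" using K(1) compact_imp_closed by blast
    then have "(\<phi> has_derivative (\<lambda>_. 0)) (at x)"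
      by (rule has_derivative_transform_within_open[OF has_derivative_const, where s = "- K"])
        (use that K(2) in auto)
    then show ?thesis by (simp add: partial_deriv_eq)
  qed
  obtain L where L: "\<And>x. \<bar>?D x\<bar> \<le> L"
  proof -
    have "bounded (?D ` K)"
      using K(1) cont continuous_on_subset by (blast intro: compact_imp_bounded compact_continuous_image)
    then obtain L where "\<forall>y\<in>?D ` K. norm y \<le> L" unfolding bounded_iff by blast
    then have "\<bar>?D x\<bar> \<le> max L 0" for x using D0[of x] by (cases "x \<in> K") auto
    then show thesis by (rule that)
  qed
  obtain R where R: "\<And>x. x \<in> K \<Longrightarrow> norm x \<le> R"
    using compact_imp_bounded[OF K(1)] unfolding bounded_iff by blast
  define h where "h n = inverse (real (Suc n))" for n
  have h: "0 < h n" "h n \<le> 1" for n by (auto simp: h_def divide_simps)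
  let ?q = "\<lambda>n x. (\<phi> (x + h n *\<^sub>R ?e) - \<phi> x) / h n"
  have [measurable]: "\<phi> \<in> borel_measurable borel" "?D \<in> borel_measurable borel"
    using c\<phi> cont by (auto intro: borel_measurable_continuous_onI)
  have "integrable lborel (\<lambda>x. indicator K x *\<^sub>R \<phi> x)"
    using K(1) c\<phi> continuous_on_subset by (blast intro: borel_integrable_compact)
  also have "(\<lambda>x. indicator K x *\<^sub>R \<phi> x) = \<phi>" using K(2) by (auto simp: indicator_def fun_eq_iff)
  finally have int: "integrable lborel \<phi>" .
  have q: "(LINT x|lborel. ?q n x) = 0" for n
  proof -
    have "integrable lborel (\<lambda>x. \<phi> (h n *\<^sub>R ?e + x))"
      "(LINT x|lborel. \<phi> (h n *\<^sub>R ?e + x)) = integral\<^sup>L lborel \<phi>"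
      using int integrable_distr_eq[of "(+) (h n *\<^sub>R ?e)" lborel borel \<phi>]
        integral_distr[of "(+) (h n *\<^sub>R ?e)" lborel borel \<phi>]
      by (simp_all add: lborel_distr_plus)
    then show ?thesis using int by (simp add: add.commute)
  qed
  have "(\<lambda>n. LINT x|lborel. ?q n x) \<longlonglongrightarrow> (LINT x|lborel. ?D x)"
  proof (rule integral_dominated_convergence[where w = "\<lambda>x. indicator (cball 0 (R + 1)) x * L"])
    show "?D \<in> borel_measurable lborel" by measurable
    show "?q n \<in> borel_measurable lborel" for n by measurable
    show "integrable lborel (\<lambda>x. indicator (cball 0 (R + 1)) x * L :: real)"
      using emeasure_bounded_finite[OF bounded_cball[of 0 "R + 1"]]
      by (intro integrable_mult_left integrable_real_indicator) (auto simp: less_top)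
    have "(\<lambda>n. ?q n x) \<longlonglongrightarrow> ?D x" for x
    proof -
      have "((\<lambda>s. (\<phi> (x + (0 + s) *\<^sub>R ?e) - \<phi> (x + 0 *\<^sub>R ?e)) / s) \<longlongrightarrow> ?D (x + 0 *\<^sub>R ?e)) (at 0)"
        using line[of x 0] unfolding DERIV_def .
      moreover have "filterlim h (at 0) sequentially"
        using h(1) LIMSEQ_inverse_real_of_nat by (auto simp: filterlim_at h_def[abs_def] less_imp_neq)
      ultimately show ?thesis by (auto dest: filterlim_compose)
    qed
    then show "AE x in lborel. (\<lambda>n. ?q n x) \<longlonglongrightarrow> ?D x" by simp
    have "\<bar>?q n x\<bar> \<le> indicator (cball 0 (R + 1)) x * L" for n x
    proof (cases "norm x \<le> R + 1")
      case True
      obtain z where "\<phi> (x + h n *\<^sub>R ?e) - \<phi> (x + 0 *\<^sub>R ?e) = (h n - 0) * ?D (x + z *\<^sub>R ?e)"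
        using MVT2[OF h(1)[of n], of "\<lambda>s. \<phi> (x + s *\<^sub>R ?e)" "\<lambda>s. ?D (x + s *\<^sub>R ?e)"] line by blast
      then have "?q n x = ?D (x + z *\<^sub>R ?e)" using h(1)[of n] by simp
      then show ?thesis using True L by (simp add: indicator_def)
    next
      case False
      have "norm x \<le> norm (x + h n *\<^sub>R ?e) + norm (h n *\<^sub>R ?e)"
        using norm_triangle_ineq4[of "x + h n *\<^sub>R ?e" "h n *\<^sub>R ?e"] by simp
      then have "norm (x + h n *\<^sub>R ?e) > R" using False h[of n] by simp
      then have "\<phi> (x + h n *\<^sub>R ?e) = 0" "\<phi> x = 0" using False R K(2) by force+
      then show ?thesis using False by simp
    qed
    then show "AE x in lborel. norm (?q n x) \<le> indicator (cball 0 (R + 1)) x * L" for n by simp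
  qed
  then show ?thesis unfolding q by (simp add: LIMSEQ_const_iff)
qed

lemma is_weak_gradient_const:
  fixes \<Omega> :: "(real ^ 'd::finite) set"
  assumes \<Omega>: "open \<Omega>" and v: "\<And>x. x \<in> \<Omega> \<Longrightarrow> v x = c"
  shows "is_weak_gradient \<Omega> v (\<lambda>_. 0)"
  unfolding is_weak_gradient_def
proof (intro conjI ballI allI)
  show "(\<lambda>x. (0 :: real ^ 'd) $ i) \<in> L2_space \<Omega>" for i by (simp add: L2_space_def)
  fix \<phi> i assume \<phi>: "\<phi> \<in> test_functions \<Omega>"
  let ?K = "closure {x. \<phi> x \<noteq> 0}"
  have smooth: "C_times (Suc 0) \<phi>" and K: "compact ?K" "?K \<subseteq> \<Omega>"
    using \<phi> unfolding test_functions_def by blast+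
  have D0: "partial_deriv i \<phi> x = 0" if "x \<notin> \<Omega>" for x
  proof -
    have "open (- ?K)" "x \<in> - ?K" using K(2) that by auto
    moreover have "0 = \<phi> y" if "y \<in> - ?K" for y
      using that closure_subset[of "{x. \<phi> x \<noteq> 0}"] by auto
    ultimately have "(\<phi> has_derivative (\<lambda>_. 0)) (at x)"
      by (rule has_derivative_transform_within_open[OF has_derivative_const])
    then show ?thesis by (simp add: partial_deriv_eq)
  qed
  have "(LINT x|lebesgue_on \<Omega>. v x * partial_deriv i \<phi> x) = (LINT x|lebesgue_on \<Omega>. c * partial_deriv i \<phi> x)"
    by (intro Bochner_Integration.integral_cong) (auto simp: v)
  also have "\<dots> = c * (LINT x|lebesgue. indicator \<Omega> x * partial_deriv i \<phi> x)"
    using \<Omega> by (simp add: integral_lebesgue_on)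
  also have "(\<lambda>x. indicator \<Omega> x * partial_deriv i \<phi> x) = partial_deriv i \<phi>"
    using D0 by (auto simp: indicator_def fun_eq_iff)
  also have "integral\<^sup>L lebesgue (partial_deriv i \<phi>) = integral\<^sup>L lborel (partial_deriv i \<phi>)"
    using smooth by (intro integral_completion) (simp add: borel_measurable_continuous_onI)
  also have "integral\<^sup>L lborel (partial_deriv i \<phi>) = 0"
  proof (rule integral_partial_deriv_eq_zero)
    show "compact ?K" by (rule K(1))
    show "\<phi> differentiable (at x)" for x using smooth by simp
    show "continuous_on UNIV (partial_deriv i \<phi>)" using smooth by simp
    show "\<phi> x = 0" if "x \<notin> ?K" for x
      using that closure_subset[of "{x. \<phi> x \<noteq> 0}"] by auto
  qed
  finally show "(LINT x|lebesgue_on \<Omega>. v x * partial_deriv i \<phi> x) = - (LINT x|lebesgue_on \<Omega>. (0 :: real ^ 'd) $ i * \<phi> x)"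
    by simp
qed

section \<open>The finite element space\<close>

lemma sum_fun_apply: "(\<Sum>a\<in>A. f a) x = (\<Sum>a\<in>A. f a x)"
  for f :: "'a \<Rightarrow> 'b \<Rightarrow> 'c::comm_monoid_add"
  by (induction A rule: infinite_finite_induct) auto

lemma finite_multi_indices: "finite {\<alpha> :: 'd::finite \<Rightarrow> nat. (\<Sum>i\<in>UNIV. \<alpha> i) \<le> k}"
proof (rule finite_subset)
  show "{\<alpha> :: 'd \<Rightarrow> nat. (\<Sum>i\<in>UNIV. \<alpha> i) \<le> k} \<subseteq> PiE UNIV (\<lambda>_. {..k})"
  proof
    fix \<alpha> :: "'d \<Rightarrow> nat" assume "\<alpha> \<in> {\<alpha>. (\<Sum>i\<in>UNIV. \<alpha> i) \<le> k}"
    moreover have "\<alpha> i \<le> (\<Sum>i\<in>UNIV. \<alpha> i)" for i by (rule member_le_sum) auto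
    ultimately show "\<alpha> \<in> PiE UNIV (\<lambda>_. {..k})"
      by (auto simp: PiE_UNIV_domain intro: order_trans)
  qed
qed (simp add: finite_PiE)

lemma polys_upto_const: "(\<lambda>_. c) \<in> polys_upto k"
proof -
  have "(\<lambda>_. c) = (\<lambda>x :: real ^ 'd. \<Sum>\<alpha> | (\<Sum>i\<in>UNIV. \<alpha> i) \<le> k.
      (if \<alpha> = (\<lambda>_. 0) then c else 0) * (\<Prod>i\<in>UNIV. (x $ i) ^ \<alpha> i))"
  proof
    fix x :: "real ^ 'd"
    have "(\<Sum>\<alpha> | (\<Sum>i\<in>UNIV. \<alpha> i) \<le> k. (if \<alpha> = (\<lambda>_. 0) then c else 0) * (\<Prod>i\<in>UNIV. (x $ i) ^ \<alpha> i))
        = (\<Sum>\<alpha> | (\<Sum>i\<in>(UNIV :: 'd set). \<alpha> i) \<le> k. if \<alpha> = (\<lambda>_. 0) then c else 0)"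
      by (intro sum.cong) auto
    also have "\<dots> = c" by (subst sum.delta[OF finite_multi_indices]) simp
    finally show "c = (\<Sum>\<alpha> | (\<Sum>i\<in>UNIV. \<alpha> i) \<le> k.
        (if \<alpha> = (\<lambda>_. 0) then c else 0) * (\<Prod>i\<in>UNIV. (x $ i) ^ \<alpha> i))" by simp
  qed
  then show ?thesis unfolding polys_upto_def by (intro CollectI exI)
qed

lemma polys_upto_lincomb:
  assumes "p \<in> polys_upto k" "q \<in> polys_upto k"
  shows "(\<lambda>x. a * p x + b * q x) \<in> polys_upto k"
proof -
  obtain c d where p: "p = (\<lambda>x. \<Sum>\<alpha> | (\<Sum>i\<in>UNIV. \<alpha> i) \<le> k. c \<alpha> * (\<Prod>i\<in>UNIV. (x $ i) ^ \<alpha> i))"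
    and q: "q = (\<lambda>x. \<Sum>\<alpha> | (\<Sum>i\<in>UNIV. \<alpha> i) \<le> k. d \<alpha> * (\<Prod>i\<in>UNIV. (x $ i) ^ \<alpha> i))"
    using assms unfolding polys_upto_def by blast
  have "(\<lambda>x. a * p x + b * q x) =
      (\<lambda>x. \<Sum>\<alpha> | (\<Sum>i\<in>UNIV. \<alpha> i) \<le> k. (a * c \<alpha> + b * d \<alpha>) * (\<Prod>i\<in>UNIV. (x $ i) ^ \<alpha> i))"
    by (simp add: p q sum_distrib_left distrib_right sum.distrib mult.assoc)
  then show ?thesis unfolding polys_upto_def by (intro CollectI exI)
qed

lemma weak_gradient:
  assumes "v \<in> H1_space \<Omega>"
  shows "is_weak_gradient \<Omega> v (weak_gradient \<Omega> v)"
  using assms someI_ex[of "is_weak_gradient \<Omega> v"] by (auto simp: H1_space_def weak_gradient_def)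

lemma H1_space_lincomb:
  assumes "bounded \<Omega>" "open \<Omega>" "v \<in> H1_space \<Omega>" "w \<in> H1_space \<Omega>"
  shows "(\<lambda>x. a * v x + b * w x) \<in> H1_space \<Omega>"
  using assms L2_space_lincomb is_weak_gradient_lincomb[OF assms(1,2)]
  unfolding H1_space_def by blast

lemma weak_gradient_lincomb:
  assumes "bounded \<Omega>" "open \<Omega>" "v \<in> H1_space \<Omega>" "w \<in> H1_space \<Omega>"
  shows "AE x in lebesgue_on \<Omega>. weak_gradient \<Omega> (\<lambda>x. a * v x + b * w x) x
    = a *\<^sub>R weak_gradient \<Omega> v x + b *\<^sub>R weak_gradient \<Omega> w x"
proof (rule weak_gradient_unique[OF assms(1,2)])
  show "is_weak_gradient \<Omega> (\<lambda>x. a * v x + b * w x) (weak_gradient \<Omega> (\<lambda>x. a * v x + b * w x))"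
    using assms by (intro weak_gradient H1_space_lincomb)
  show "is_weak_gradient \<Omega> (\<lambda>x. a * v x + b * w x)
      (\<lambda>x. a *\<^sub>R weak_gradient \<Omega> v x + b *\<^sub>R weak_gradient \<Omega> w x)"
    using assms by (intro is_weak_gradient_lincomb weak_gradient) (auto simp: H1_space_def)
qed

lemma fe_space_lincomb:
  assumes "bounded \<Omega>" "open \<Omega>" and v: "v \<in> fe_space \<Omega> \<T> k" and w: "w \<in> fe_space \<Omega> \<T> k"
  shows "(\<lambda>x. a * v x + b * w x) \<in> fe_space \<Omega> \<T> k"
proof -
  have "\<exists>p\<in>polys_upto k. \<forall>x\<in>T. a * v x + b * w x = p x" if T: "T \<in> \<T>" for T
  proof -
    obtain p q where "p \<in> polys_upto k" "q \<in> polys_upto k" "\<forall>x\<in>T. v x = p x" "\<forall>x\<in>T. w x = q x"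
      using v w T unfolding fe_space_def by blast
    then show ?thesis using polys_upto_lincomb[of p k q a b] by (intro bexI[of _ "\<lambda>x. a * p x + b * q x"]) auto
  qed
  moreover have "continuous_on (closure \<Omega>) (\<lambda>x. a * v x + b * w x)"
    using v w unfolding fe_space_def by (intro continuous_intros) auto
  ultimately show ?thesis
    using v w H1_space_lincomb[OF assms(1,2)] unfolding fe_space_def by auto
qed

lemma fe_space_const:
  assumes \<Omega>: "bounded \<Omega>" "open \<Omega>" and mesh: "mesh_of \<Omega> \<T>"
  shows "(\<lambda>x. if x \<in> closure \<Omega> then c else 0) \<in> fe_space \<Omega> \<T> k" (is "?v \<in> _")
proof -
  have cont: "continuous_on (closure \<Omega>) ?v" by (simp cong: continuous_on_cong)
  have "?v x = c" if "x \<in> \<Omega>" for x using that closure_subset by auto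
  then have "?v \<in> H1_space \<Omega>"
    using is_weak_gradient_const[OF \<Omega>(2), of ?v] continuous_bounded_measurable(3)[OF \<Omega> cont]
    unfolding H1_space_def by blast
  moreover have "\<forall>x\<in>T. ?v x = c" if "T \<in> \<T>" for T
    using that mesh unfolding mesh_of_def by auto
  ultimately show ?thesis
    using cont polys_upto_const[of c k] unfolding fe_space_def by auto
qed

lemma subspace_fe_space:
  assumes "bounded \<Omega>" "open \<Omega>" "mesh_of \<Omega> \<T>"
  shows "subspace (fe_space \<Omega> \<T> k)"
proof (rule subspaceI)
  show "0 \<in> fe_space \<Omega> \<T> k"
    using fe_space_const[OF assms, of 0 k] by (simp add: zero_fun_def)
  fix v w assume "v \<in> fe_space \<Omega> \<T> k" "w \<in> fe_space \<Omega> \<T> k"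
  then show "v + w \<in> fe_space \<Omega> \<T> k"
    using fe_space_lincomb[OF assms(1,2), of v \<T> k w 1 1] by (simp add: plus_fun_def)
next
  fix c v assume "v \<in> fe_space \<Omega> \<T> k"
  then show "c *\<^sub>R v \<in> fe_space \<Omega> \<T> k"
    using fe_space_lincomb[OF assms(1,2), of v \<T> k v c 0] by (simp add: scaleR_fun_def)
qed

text \<open>
  Assign to each point of \<open>closure \<Omega>\<close> one simplex containing it. The resulting finitely many pieces
  are disjoint and \<open>v\<close> is a polynomial on each, so \<open>v\<close> is a combination of monomials cut off to
  the pieces. These spanning functions need not lie in the finite element space.
\<close>

lemma fe_space_finite_dim:
  fixes \<Omega> :: "(real ^ 'd::finite) set"
  assumes mesh: "mesh_of \<Omega> \<T>"
  shows "\<exists>C. finite C \<and> fe_space \<Omega> \<T> k \<subseteq> span C"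
proof -
  have fin: "finite \<T>" and cover: "closure \<Omega> = \<Union>\<T>"
    using mesh by (auto simp: mesh_of_def triangulation_def)
  \<comment> \<open>a choice of one simplex for each point makes the pieces disjoint\<close>
  define cell where "cell x = (SOME T. T \<in> \<T> \<and> x \<in> T)" for x
  have cell: "cell x \<in> \<T>" "x \<in> cell x" if "x \<in> closure \<Omega>" for x
    using someI_ex[of "\<lambda>T. T \<in> \<T> \<and> x \<in> T"] that cover by (auto simp: cell_def)
  let ?S = "{\<alpha> :: 'd \<Rightarrow> nat. (\<Sum>i\<in>UNIV. \<alpha> i) \<le> k}"
  define e where "e = (\<lambda>(T, \<alpha>) x. if x \<in> closure \<Omega> \<and> cell x = T then \<Prod>i\<in>UNIV. (x $ i) ^ \<alpha> i else 0 :: real)"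
  have "v \<in> span (e ` (\<T> \<times> ?S))" if v: "v \<in> fe_space \<Omega> \<T> k" for v
  proof -
    have "\<forall>T\<in>\<T>. \<exists>c. \<forall>x\<in>T. v x = (\<Sum>\<alpha>\<in>?S. c \<alpha> * (\<Prod>i\<in>UNIV. (x $ i) ^ \<alpha> i))"
    proof
      fix T assume "T \<in> \<T>"
      then obtain p where "p \<in> polys_upto k" "\<forall>x\<in>T. v x = p x"
        using v unfolding fe_space_def by blast
      then show "\<exists>c. \<forall>x\<in>T. v x = (\<Sum>\<alpha>\<in>?S. c \<alpha> * (\<Prod>i\<in>UNIV. (x $ i) ^ \<alpha> i))"
        unfolding polys_upto_def by auto
    qed
    then obtain c where c: "\<And>T x. T \<in> \<T> \<Longrightarrow> x \<in> T \<Longrightarrow> v x = (\<Sum>\<alpha>\<in>?S. c T \<alpha> * (\<Prod>i\<in>UNIV. (x $ i) ^ \<alpha> i))"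
      unfolding bchoice_iff by blast
    have "v = (\<Sum>T\<in>\<T>. \<Sum>\<alpha>\<in>?S. c T \<alpha> *\<^sub>R e (T, \<alpha>))"
    proof
      fix x
      have "(\<Sum>T\<in>\<T>. \<Sum>\<alpha>\<in>?S. c T \<alpha> *\<^sub>R e (T, \<alpha>)) x
        = (\<Sum>T\<in>\<T>. if cell x = T then (\<Sum>\<alpha>\<in>?S. c T \<alpha> * e (T, \<alpha>) x) else 0)"
        unfolding sum_fun_apply by (intro sum.cong) (auto simp: e_def)
      also have "\<dots> = v x"
      proof (cases "x \<in> closure \<Omega>")
        case True
        then show ?thesis using cell[OF True] c[OF cell[OF True]] fin by (simp add: e_def)
      next
        case False
        then show ?thesis using v by (auto simp: e_def fe_space_def intro!: sum.neutral)
      qed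
      finally show "v x = (\<Sum>T\<in>\<T>. \<Sum>\<alpha>\<in>?S. c T \<alpha> *\<^sub>R e (T, \<alpha>)) x" by simp
    qed
    also have "\<dots> \<in> span (e ` (\<T> \<times> ?S))"
      by (intro span_sum span_scale span_base) auto
    finally show ?thesis .
  qed
  then show ?thesis using fin finite_multi_indices
    by (intro exI[of _ "e ` (\<T> \<times> ?S)"]) auto
qed

lemma fe_space_continuous:
  assumes "v \<in> fe_space \<Omega> \<T> k"
  shows "continuous_on (closure \<Omega>) v" "v \<in> H1_space \<Omega>" "v \<in> L2_space \<Omega>"
  using assms by (auto simp: fe_space_def H1_space_def)

text \<open>
  A function with zero norm vanishes almost everywhere on \<open>\<Omega>\<close>. By continuity it vanishes on
  \<open>\<Omega>\<close>, as a nonempty open set is not negligible, and then on the closure; outside the closure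
  it is zero by convention.
\<close>

lemma fe_space_L2_definite:
  assumes \<Omega>: "bounded \<Omega>" "open \<Omega>" and v: "v \<in> fe_space \<Omega> \<T> k" and zero: "L2_inner \<Omega> v v = 0"
  shows "v = 0"
proof -
  have int: "integrable (lebesgue_on \<Omega>) (\<lambda>x. v x * v x)"
    using fe_space_continuous(3)[OF v] by (intro L2_space_mult_integrable)
  have "AE x in lebesgue_on \<Omega>. v x * v x = 0"
    using integral_nonneg_eq_0_iff_AE[OF int] zero by (auto simp: L2_inner_def)
  moreover have "(AE x in lebesgue_on \<Omega>. v x * v x = 0) \<longleftrightarrow> (AE x in lebesgue. x \<in> \<Omega> \<longrightarrow> v x * v x = 0)"
    by (rule AE_restrict_space_iff) (use \<Omega> in simp)
  ultimately have ae: "AE x in lebesgue. x \<notin> {x \<in> \<Omega>. v x \<noteq> 0}" by simp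
  have op: "open {x \<in> \<Omega>. v x \<noteq> 0}"
  proof -
    have "open (\<Omega> \<inter> v -` (- {0}))"
      using continuous_on_subset[OF fe_space_continuous(1)[OF v] closure_subset] \<Omega>(2)
      by (intro continuous_open_preimage) auto
    moreover have "\<Omega> \<inter> v -` (- {0}) = {x \<in> \<Omega>. v x \<noteq> 0}" by auto
    ultimately show ?thesis by simp
  qed
  then have "{x \<in> \<Omega>. v x \<noteq> 0} \<in> null_sets lebesgue"
    using ae by (subst AE_iff_null_sets) auto
  then have "negligible {x \<in> \<Omega>. v x \<noteq> 0}" by (simp add: negligible_iff_null_sets)
  then have "{x \<in> \<Omega>. v x \<noteq> 0} = {}" using op open_not_negligible by blast
  then have "v x = 0" if "x \<in> closure \<Omega>" for x
    using continuous_constant_on_closure[OF fe_space_continuous(1)[OF v], of 0 x] that by blast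
  moreover have "v x = 0" if "x \<notin> closure \<Omega>" for x using v that by (simp add: fe_space_def)
  ultimately show ?thesis by (auto simp: fun_eq_iff)
qed

section \<open>The forms of the scheme\<close>

lemma L2_inner_add: "f \<in> L2_space \<Omega> \<Longrightarrow> g \<in> L2_space \<Omega> \<Longrightarrow> h \<in> L2_space \<Omega> \<Longrightarrow>
    L2_inner \<Omega> f (g + h) = L2_inner \<Omega> f g + L2_inner \<Omega> f h"
  unfolding L2_inner_def by (simp add: distrib_left L2_space_mult_integrable)

lemma L2_inner_scale: "L2_inner \<Omega> f (c *\<^sub>R g) = c * L2_inner \<Omega> f g"
  unfolding L2_inner_def by (simp add: mult.left_commute)

lemma L2_inner_commute: "L2_inner \<Omega> f g = L2_inner \<Omega> g f"
  unfolding L2_inner_def by (simp add: mult.commute)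

lemma L2_inner_linear:
  "f \<in> L2_space \<Omega> \<Longrightarrow> V \<subseteq> L2_space \<Omega> \<Longrightarrow> linear_functional_on V (L2_inner \<Omega> f)"
  by (intro linear_functional_onI L2_inner_add L2_inner_scale) auto

lemma L2_inner_form:
  assumes "V \<subseteq> L2_space \<Omega>"
  shows "symmetric_form_on V (L2_inner \<Omega>)"
  unfolding symmetric_form_on_def
  using L2_inner_linear[OF _ assms] assms L2_inner_commute[of \<Omega>]
  by (metis (no_types, lifting) ext subsetD)

lemma weighted_L2_form:
  assumes V: "V \<subseteq> L2_space \<Omega>"
    and a: "a \<in> borel_measurable (lebesgue_on \<Omega>)" "\<And>x. x \<in> \<Omega> \<Longrightarrow> \<bar>a x\<bar> \<le> C"
  shows "symmetric_form_on V (\<lambda>f g. L2_inner \<Omega> (\<lambda>x. a x * f x) g)"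
  unfolding symmetric_form_on_def
proof (intro conjI ballI linear_functional_onI)
  have int: "integrable (lebesgue_on \<Omega>) (\<lambda>x. a x * (f x * g x))" if "f \<in> V" "g \<in> V" for f g
    using that V by (intro bounded_coefficient_integrable[OF _ a] L2_space_mult_integrable) auto
  show "L2_inner \<Omega> (\<lambda>x. a x * (f + h) x) g = L2_inner \<Omega> (\<lambda>x. a x * f x) g + L2_inner \<Omega> (\<lambda>x. a x * h x) g"
    if "f \<in> V" "h \<in> V" "g \<in> V" for f g h
    using int[OF that(1,3)] int[OF that(2,3)] by (simp add: L2_inner_def mult.assoc distrib_left distrib_right)
  show "L2_inner \<Omega> (\<lambda>x. a x * (c *\<^sub>R f) x) g = c * L2_inner \<Omega> (\<lambda>x. a x * f x) g" for c f g
    by (simp add: L2_inner_def mult.assoc mult.left_commute)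
  show "L2_inner \<Omega> (\<lambda>x. a x * f x) g = L2_inner \<Omega> (\<lambda>x. a x * g x) f" for f g
    by (simp add: L2_inner_def mult_ac)
qed

lemma A_form_integrable:
  fixes \<Omega> :: "(real ^ 'd::finite) set"
  assumes a: "a \<in> borel_measurable (lebesgue_on \<Omega>)" "\<And>x. x \<in> \<Omega> \<Longrightarrow> \<bar>a x\<bar> \<le> C"
    and v: "v \<in> H1_space \<Omega>" and w: "w \<in> H1_space \<Omega>"
  shows "integrable (lebesgue_on \<Omega>) (\<lambda>x. a x * (weak_gradient \<Omega> v x \<bullet> weak_gradient \<Omega> w x))"
proof (rule bounded_coefficient_integrable[OF _ a])
  have "(\<lambda>x. weak_gradient \<Omega> v x $ i) \<in> L2_space \<Omega>" "(\<lambda>x. weak_gradient \<Omega> w x $ i) \<in> L2_space \<Omega>" for i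
    using weak_gradient[OF v] weak_gradient[OF w] by (auto simp: is_weak_gradient_def)
  then show "integrable (lebesgue_on \<Omega>) (\<lambda>x. weak_gradient \<Omega> v x \<bullet> weak_gradient \<Omega> w x)"
    unfolding inner_vec_def inner_real_def
    by (intro Bochner_Integration.integrable_sum L2_space_mult_integrable)
qed

text \<open>
  The chosen weak gradients depend linearly on the function only almost everywhere, which is enough
  under the integral.
\<close>

lemma A_form_symmetric:
  assumes \<Omega>: "bounded \<Omega>" "open \<Omega>" and V: "subspace V" "V \<subseteq> H1_space \<Omega>"
    and a: "a \<in> borel_measurable (lebesgue_on \<Omega>)" "\<And>x. x \<in> \<Omega> \<Longrightarrow> \<bar>a x\<bar> \<le> C"
  shows "symmetric_form_on V (A_form \<Omega> a)"
proof -
  have lin: "A_form \<Omega> a (\<lambda>x. b * v x + c * w x) z = b * A_form \<Omega> a v z + c * A_form \<Omega> a w z"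
    if "v \<in> V" "w \<in> V" "z \<in> V" for b c v w z
  proof -
    have mem: "v \<in> H1_space \<Omega>" "w \<in> H1_space \<Omega>" "z \<in> H1_space \<Omega>" using that V by auto
    note int = A_form_integrable[OF a mem(1,3)] A_form_integrable[OF a mem(2,3)]
    have "A_form \<Omega> a (\<lambda>x. b * v x + c * w x) z = (LINT x|lebesgue_on \<Omega>.
        b * (a x * (weak_gradient \<Omega> v x \<bullet> weak_gradient \<Omega> z x))
        + c * (a x * (weak_gradient \<Omega> w x \<bullet> weak_gradient \<Omega> z x)))"
      unfolding A_form_def
    proof (rule integral_cong_AE)
      show "(\<lambda>x. a x * (weak_gradient \<Omega> (\<lambda>x. b * v x + c * w x) x \<bullet> weak_gradient \<Omega> z x))
          \<in> borel_measurable (lebesgue_on \<Omega>)"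
        using A_form_integrable[OF a H1_space_lincomb[OF \<Omega> mem(1,2)] mem(3)] by blast
      show "AE x in lebesgue_on \<Omega>. a x * (weak_gradient \<Omega> (\<lambda>x. b * v x + c * w x) x \<bullet> weak_gradient \<Omega> z x)
          = b * (a x * (weak_gradient \<Omega> v x \<bullet> weak_gradient \<Omega> z x))
            + c * (a x * (weak_gradient \<Omega> w x \<bullet> weak_gradient \<Omega> z x))"
        using weak_gradient_lincomb[OF \<Omega> mem(1,2), of b c]
        by eventually_elim (simp add: inner_add_left distrib_left mult.left_commute)
    qed (use int in auto)
    also have "\<dots> = b * A_form \<Omega> a v z + c * A_form \<Omega> a w z"
      using int by (simp add: A_form_def)
    finally show ?thesis .
  qed
  show ?thesis
    unfolding symmetric_form_on_def
  proof (intro conjI ballI linear_functional_onI)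
    show "A_form \<Omega> a (v + w) z = A_form \<Omega> a v z + A_form \<Omega> a w z"
      if "v \<in> V" "w \<in> V" "z \<in> V" for v w z
      using lin[OF that, of 1 1] by (simp add: plus_fun_def)
    show "A_form \<Omega> a (c *\<^sub>R v) z = c * A_form \<Omega> a v z" if "v \<in> V" "z \<in> V" for c v z
      using lin[OF that(1,1,2), of c 0] by (simp add: scaleR_fun_def)
    show "A_form \<Omega> a v w = A_form \<Omega> a w v" for v w
      by (simp add: A_form_def inner_commute)
  qed
qed

lemma A_form_nonneg:
  assumes "\<And>x. x \<in> \<Omega> \<Longrightarrow> a x \<ge> 0"
  shows "A_form \<Omega> a v v \<ge> 0"
  unfolding A_form_def using assms by (intro Bochner_Integration.integral_nonneg) auto

text \<open>
  \<open>L2_proj\<close> is a definite description; it denotes a finite element function because the condition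
  that \<open>f - p\<close> be orthogonal to the space is a nondegenerate variational problem for \<open>p\<close>.
\<close>

lemma L2_proj_in_fe_space:
  assumes \<Omega>: "bounded \<Omega>" "open \<Omega>" and mesh: "mesh_of \<Omega> \<T>" and f: "f \<in> L2_space \<Omega>"
  shows "L2_proj \<Omega> (fe_space \<Omega> \<T> k) f \<in> fe_space \<Omega> \<T> k" (is "L2_proj \<Omega> ?V f \<in> _")
proof -
  have V: "subspace ?V" "?V \<subseteq> L2_space \<Omega>"
    using subspace_fe_space[OF \<Omega> mesh] fe_space_continuous(3) by blast+
  obtain C where C: "finite C" "?V \<subseteq> span C" using fe_space_finite_dim[OF mesh] by blast
  have form: "symmetric_form_on ?V (L2_inner \<Omega>)" by (rule L2_inner_form[OF V(2)])
  have "\<exists>!p. p \<in> ?V \<and> (\<forall>v\<in>?V. L2_inner \<Omega> p v = L2_inner \<Omega> f v)"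
  proof (rule finite_dim_variational_problem[OF V(1) C])
    show "linear_functional_on ?V (\<lambda>z. L2_inner \<Omega> z y)" "linear_functional_on ?V (L2_inner \<Omega> y)"
      if "y \<in> ?V" for y
      using form that symmetric_form_on_right[OF form V(1)] by (auto simp: symmetric_form_on_def)
    show "linear_functional_on ?V (L2_inner \<Omega> f)" by (rule L2_inner_linear[OF f V(2)])
    show "z = 0" if "z \<in> ?V" "\<And>y. y \<in> ?V \<Longrightarrow> L2_inner \<Omega> z y = 0" for z
      using fe_space_L2_definite[OF \<Omega>] that by blast
  qed
  moreover have "L2_inner \<Omega> (\<lambda>x. f x - p x) v = L2_inner \<Omega> f v - L2_inner \<Omega> p v"
    if "p \<in> ?V" "v \<in> ?V" for p v
  proof -
    have "integrable (lebesgue_on \<Omega>) (\<lambda>x. f x * v x)" "integrable (lebesgue_on \<Omega>) (\<lambda>x. p x * v x)"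
      using that V(2) f by (auto intro!: L2_space_mult_integrable)
    then show ?thesis by (simp add: L2_inner_def left_diff_distrib)
  qed
  ultimately have "\<exists>!p. p \<in> ?V \<and> (\<forall>v\<in>?V. L2_inner \<Omega> (\<lambda>x. f x - p x) v = 0)"
    by (smt (verit, best))
  from theI'[OF this] show ?thesis unfolding L2_proj_def by blast
qed

section \<open>The scheme on the finite element space\<close>

text \<open>
  Admissibility keeps the values of \<open>u\<close> where \<open>F\<close>, \<open>F'\<close> and \<open>M\<close> are continuous and
  \<open>F + B\<close> is positive. Since \<open>closure \<Omega>\<close> is compact, the coefficients of the forms are bounded.
\<close>

lemma admissible_coefficients:
  fixes \<Omega> :: "(real ^ 'd::finite) set"
  assumes \<Omega>: "bounded \<Omega>" "open \<Omega>" and u: "continuous_on (closure \<Omega>) u" "admissible \<Omega> I J F B u"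
    and F: "\<And>s. s \<in> I \<Longrightarrow> (F has_real_derivative F' s) (at s within I)" "continuous_on I F'"
    and M: "continuous_on J M"
  shows "continuous_on (closure \<Omega>) (\<lambda>x. H_fun F F' B (u x))" "continuous_on (closure \<Omega>) (\<lambda>x. M (u x))"
proof -
  have mem: "u ` closure \<Omega> \<subseteq> I" "u ` closure \<Omega> \<subseteq> J" and pos: "\<And>x. x \<in> closure \<Omega> \<Longrightarrow> F (u x) + B > 0"
    using u(2) by (auto simp: admissible_def)
  have cF: "continuous_on I F"
    using F(1) DERIV_continuous_on by blast
  note comp = continuous_on_compose2[OF _ u(1)]
  show "continuous_on (closure \<Omega>) (\<lambda>x. H_fun F F' B (u x))"
    unfolding H_fun_def
    by (intro continuous_intros comp[OF F(2) mem(1)] comp[OF cF mem(1)]) (use pos in force)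
  show "continuous_on (closure \<Omega>) (\<lambda>x. M (u x))" by (rule comp[OF M mem(2)])
qed

lemma fe_sav_scheme:
  fixes \<Omega> :: "(real ^ 'd::finite) set"
  assumes \<Omega>: "bounded \<Omega>" "open \<Omega>" and mesh: "mesh_of \<Omega> \<T>" and dt: "dt > 0"
    and h: "continuous_on (closure \<Omega>) h"
    and m: "continuous_on (closure \<Omega>) m" "\<And>x. x \<in> closure \<Omega> \<Longrightarrow> m x \<ge> 0"
  shows "sav_scheme (fe_space \<Omega> \<T> k) (L2_inner \<Omega>) (A_form \<Omega> m) (A_form \<Omega> (\<lambda>_. \<epsilon>\<^sup>2))
    (\<lambda>f g. L2_inner \<Omega> (\<lambda>x. h x * f x) g) dt"
proof
  let ?V = "fe_space \<Omega> \<T> k"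
  have V: "subspace ?V" "?V \<subseteq> L2_space \<Omega>" "?V \<subseteq> H1_space \<Omega>"
    using subspace_fe_space[OF \<Omega> mesh] fe_space_continuous by blast+
  obtain Ch where Ch: "\<And>x. x \<in> \<Omega> \<Longrightarrow> \<bar>h x\<bar> \<le> Ch"
    using continuous_bounded_measurable(2)[OF \<Omega> h] by blast
  obtain Cm where Cm: "\<And>x. x \<in> \<Omega> \<Longrightarrow> \<bar>m x\<bar> \<le> Cm"
    using continuous_bounded_measurable(2)[OF \<Omega> m(1)] by blast
  show "subspace ?V" by (rule V(1))
  show "\<exists>C. finite C \<and> ?V \<subseteq> span C" by (rule fe_space_finite_dim[OF mesh])
  show "symmetric_form_on ?V (L2_inner \<Omega>)" by (rule L2_inner_form[OF V(2)])
  show "symmetric_form_on ?V (A_form \<Omega> m)"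
    by (rule A_form_symmetric[OF \<Omega> V(1,3) continuous_bounded_measurable(1)[OF \<Omega> m(1)] Cm])
  show "symmetric_form_on ?V (A_form \<Omega> (\<lambda>_. \<epsilon>\<^sup>2))"
    by (rule A_form_symmetric[OF \<Omega> V(1,3), where C = "\<epsilon>\<^sup>2"]) auto
  show "symmetric_form_on ?V (\<lambda>f g. L2_inner \<Omega> (\<lambda>x. h x * f x) g)"
    by (rule weighted_L2_form[OF V(2) continuous_bounded_measurable(1)[OF \<Omega> h] Ch])
  show "L2_inner \<Omega> v v \<ge> 0" for v
    unfolding L2_inner_def by (intro Bochner_Integration.integral_nonneg) auto
  show "v = 0" if "v \<in> ?V" "L2_inner \<Omega> v v = 0" for v
    using fe_space_L2_definite[OF \<Omega>] that by blast
  show "A_form \<Omega> m v v \<ge> 0" for v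
    using m(2) closure_subset by (intro A_form_nonneg) blast
  show "A_form \<Omega> (\<lambda>_. \<epsilon>\<^sup>2) v v \<ge> 0" for v by (intro A_form_nonneg) simp
  show "dt > 0" by (rule dt)
qed

lemma scheme_step_iff:
  assumes sav: "sav_scheme V (L2_inner \<Omega>) (A_form \<Omega> (\<lambda>x. M (u x))) (A_form \<Omega> (\<lambda>_. \<epsilon>\<^sup>2))
      (\<lambda>f g. L2_inner \<Omega> (\<lambda>x. H_fun F F' B (u x) * f x) g) dt"
  shows "scheme_step \<Omega> V \<epsilon> F F' B M dt u U u' w' U' \<longleftrightarrow>
    sav_scheme.step V (L2_inner \<Omega>) (A_form \<Omega> (\<lambda>x. M (u x))) (A_form \<Omega> (\<lambda>_. \<epsilon>\<^sup>2))
      (\<lambda>f g. L2_inner \<Omega> (\<lambda>x. H_fun F F' B (u x) * f x) g) dt u U u' w' U'"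
proof -
  interpret sav_scheme V "L2_inner \<Omega>" "A_form \<Omega> (\<lambda>x. M (u x))" "A_form \<Omega> (\<lambda>_. \<epsilon>\<^sup>2)"
    "\<lambda>f g. L2_inner \<Omega> (\<lambda>x. H_fun F F' B (u x) * f x) g" dt by (rule sav)
  have quotient: "L2_inner \<Omega> (\<lambda>x. (f x - g x) / dt) v = L2_inner \<Omega> (f - g) v / dt" for f g v
    by (simp add: L2_inner_def)
  have weighted: "L2_inner \<Omega> (\<lambda>x. h x * ((f x - g x) / dt)) v = L2_inner \<Omega> (\<lambda>x. h x * (f - g) x) v / dt"
    for f g h v
    by (simp add: L2_inner_def)
  have "(a / dt = - b) = (a = - dt * b)" "(a / dt = 1 / 2 * (c / dt)) = (a = 1 / 2 * c)" for a b c
    using dt by (auto simp: field_simps)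
  then show ?thesis
    unfolding scheme_step_def step_def quotient weighted by simp
qed

text \<open>
  The extension by zero of the constant \<open>1\<close> is a test function, and its weak gradient vanishes
  almost everywhere.
\<close>

lemma scheme_step_mass:
  assumes \<Omega>: "bounded \<Omega>" "open \<Omega>" and mesh: "mesh_of \<Omega> \<T>" and dt: "dt > 0"
    and u: "u \<in> fe_space \<Omega> \<T> k"
    and step: "scheme_step \<Omega> (fe_space \<Omega> \<T> k) \<epsilon> F F' B M dt u U u' w' U'"
  shows "(LINT x|lebesgue_on \<Omega>. u' x) = (LINT x|lebesgue_on \<Omega>. u x)"
proof -
  define one where "one = (\<lambda>x. if x \<in> closure \<Omega> then 1 else 0 :: real)"
  have one: "one \<in> fe_space \<Omega> \<T> k" unfolding one_def by (rule fe_space_const[OF \<Omega> mesh])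
  have one_eq: "one x = 1" if "x \<in> \<Omega>" for x
    using that closure_subset by (auto simp: one_def)
  have "AE x in lebesgue_on \<Omega>. weak_gradient \<Omega> one x = 0"
    using weak_gradient_unique[OF \<Omega> weak_gradient[OF fe_space_continuous(2)[OF one]]
        is_weak_gradient_const[OF \<Omega>(2) one_eq]] .
  then have "AE x in lebesgue_on \<Omega>. M (u x) * (weak_gradient \<Omega> w' x \<bullet> weak_gradient \<Omega> one x) = 0"
    by eventually_elim simp
  then have "A_form \<Omega> (\<lambda>x. M (u x)) w' one = 0"
    unfolding A_form_def by (rule integral_eq_zero_AE)
  then have "L2_inner \<Omega> (\<lambda>x. (u' x - u x) / dt) one = 0"
    using step one unfolding scheme_step_def by simp
  moreover have "L2_inner \<Omega> (\<lambda>x. (u' x - u x) / dt) one = (LINT x|lebesgue_on \<Omega>. (u' x - u x) / dt)"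
    unfolding L2_inner_def by (intro Bochner_Integration.integral_cong) (auto simp: one_eq)
  moreover have int: "integrable (lebesgue_on \<Omega>) v" if v: "v \<in> fe_space \<Omega> \<T> k" for v
  proof -
    have "integrable (lebesgue_on \<Omega>) (\<lambda>x. v x * one x)"
      by (intro L2_space_mult_integrable fe_space_continuous(3)[OF v] fe_space_continuous(3)[OF one])
    moreover have "integrable (lebesgue_on \<Omega>) (\<lambda>x. v x * one x) \<longleftrightarrow> integrable (lebesgue_on \<Omega>) v"
      by (intro Bochner_Integration.integrable_cong) (auto simp: one_eq)
    ultimately show ?thesis by simp
  qed
  ultimately show ?thesis
    using dt int[OF u] int[of u'] step by (simp add: scheme_step_def)
qed

theorem lemma2p2:
  fixes \<Omega> :: "(real ^ 'd::finite) set" and \<T> :: "(real ^ 'd) set set" and k :: nat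
    and \<epsilon> \<sigma> B dt :: real and I J :: "real set" and F F' M :: "real \<Rightarrow> real"
    and u0 :: "real ^ 'd \<Rightarrow> real"
  defines "V \<equiv> fe_space \<Omega> \<T> k"
  assumes dim: "CARD('d) = 2 \<or> CARD('d) = 3"
    and domain: "open \<Omega>" "connected \<Omega>" "bounded \<Omega>" "\<Omega> \<noteq> {}"
    and mesh: "mesh_of \<Omega> \<T>" "quasi_uniform \<sigma> \<T>"
    and k: "k \<ge> 1" and eps: "\<epsilon> > 0" and dt: "dt > 0"
    and F: "is_interval I" "\<And>s. s \<in> I \<Longrightarrow> (F has_real_derivative F' s) (at s within I)"
      "continuous_on I F'"
    and B: "B \<ge> 0"
    and M: "continuous_on J M" "\<And>s. s \<in> J \<Longrightarrow> M s \<ge> 0"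
    and u0: "u0 \<in> L2_space \<Omega>" "(\<lambda>x. sqrt (F (u0 x) + B)) \<in> L2_space \<Omega>"
      "AE x in lebesgue_on \<Omega>. u0 x \<in> I \<and> F (u0 x) + B > 0"
  shows "(\<forall>u\<in>V. \<forall>U\<in>V. admissible \<Omega> I J F B u \<longrightarrow>
            (\<exists>!z. case z of (u', w', U') \<Rightarrow> scheme_step \<Omega> V \<epsilon> F F' B M dt u U u' w' U')) \<and>
         (\<forall>N u w U. scheme_run \<Omega> V \<epsilon> I J F F' B M dt u0 N u w U \<longrightarrow>
            (u 0 \<in> V \<and> U 0 \<in> V) \<and>
            (\<forall>n. 0 < n \<and> n \<le> N \<longrightarrow>
               (LINT x|lebesgue_on \<Omega>. u n x) = (LINT x|lebesgue_on \<Omega>. u 0 x)) \<and>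
            (\<forall>n<N. energy \<Omega> \<epsilon> B (u (Suc n)) (U (Suc n)) =
               energy \<Omega> \<epsilon> B (u n) (U n)
               - (L2_nrm \<Omega> (\<lambda>x. U (Suc n) x - U n x))\<^sup>2
               - dt * A_form \<Omega> (\<lambda>x. M (u n x)) (w (Suc n)) (w (Suc n))
               - 1 / 2 * A_form \<Omega> (\<lambda>_. \<epsilon>\<^sup>2) (\<lambda>x. u (Suc n) x - u n x) (\<lambda>x. u (Suc n) x - u n x)))"
proof -
  note \<Omega> = domain(3,1)
  have sav: "sav_scheme V (L2_inner \<Omega>) (A_form \<Omega> (\<lambda>x. M (u x))) (A_form \<Omega> (\<lambda>_. \<epsilon>\<^sup>2))
      (\<lambda>f g. L2_inner \<Omega> (\<lambda>x. H_fun F F' B (u x) * f x) g) dt"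
    if "u \<in> V" "admissible \<Omega> I J F B u" for u
    unfolding V_def
  proof (rule fe_sav_scheme[OF \<Omega> mesh(1) dt])
    have cont: "continuous_on (closure \<Omega>) u"
      using that(1) unfolding V_def by (rule fe_space_continuous(1))
    show "continuous_on (closure \<Omega>) (\<lambda>x. H_fun F F' B (u x))" "continuous_on (closure \<Omega>) (\<lambda>x. M (u x))"
      using admissible_coefficients[OF \<Omega> cont that(2) F(2,3) M(1)] by auto
    show "M (u x) \<ge> 0" if "x \<in> closure \<Omega>" for x
      using \<open>admissible \<Omega> I J F B u\<close> that M(2) by (auto simp: admissible_def)
  qed
  have "\<exists>!z. case z of (u', w', U') \<Rightarrow> scheme_step \<Omega> V \<epsilon> F F' B M dt u U u' w' U'"
    if "u \<in> V" "U \<in> V" "admissible \<Omega> I J F B u" for u U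
    unfolding scheme_step_iff[OF sav[OF that(1,3)]]
    by (rule sav_scheme.unique_step[OF sav[OF that(1,3)] that(1,2)])
  moreover have "(u 0 \<in> V \<and> U 0 \<in> V) \<and>
      (\<forall>n. 0 < n \<and> n \<le> N \<longrightarrow> (LINT x|lebesgue_on \<Omega>. u n x) = (LINT x|lebesgue_on \<Omega>. u 0 x)) \<and>
      (\<forall>n<N. energy \<Omega> \<epsilon> B (u (Suc n)) (U (Suc n)) =
         energy \<Omega> \<epsilon> B (u n) (U n)
         - (L2_nrm \<Omega> (\<lambda>x. U (Suc n) x - U n x))\<^sup>2
         - dt * A_form \<Omega> (\<lambda>x. M (u n x)) (w (Suc n)) (w (Suc n))
         - 1 / 2 * A_form \<Omega> (\<lambda>_. \<epsilon>\<^sup>2) (\<lambda>x. u (Suc n) x - u n x) (\<lambda>x. u (Suc n) x - u n x))"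
    if run: "scheme_run \<Omega> V \<epsilon> I J F F' B M dt u0 N u w U" for N u w U
  proof -
    have adm: "admissible \<Omega> I J F B (u n)"
      and step: "scheme_step \<Omega> V \<epsilon> F F' B M dt (u n) (U n) (u (Suc n)) (w (Suc n)) (U (Suc n))"
      if "n < N" for n
      using run that unfolding scheme_run_def by blast+
    have init: "u 0 \<in> V" "U 0 \<in> V"
      using run L2_proj_in_fe_space[OF \<Omega> mesh(1)] u0(1,2) unfolding scheme_run_def V_def by auto
    have mem: "u n \<in> V \<and> U n \<in> V" if "n \<le> N" for n
    proof (cases n)
      case (Suc m)
      then show ?thesis using step[of m] that by (auto simp: scheme_step_def)
    qed (use init in simp)
    have mass: "(LINT x|lebesgue_on \<Omega>. u n x) = (LINT x|lebesgue_on \<Omega>. u 0 x)" if "n \<le> N" for n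
      using that
    proof (induction n)
      case (Suc n)
      have "(LINT x|lebesgue_on \<Omega>. u (Suc n) x) = (LINT x|lebesgue_on \<Omega>. u n x)"
        using scheme_step_mass[OF \<Omega> mesh(1) dt] mem[of n] step[of n] Suc.prems unfolding V_def by auto
      then show ?case using Suc by simp
    qed simp
    have "energy \<Omega> \<epsilon> B (u (Suc n)) (U (Suc n)) =
         energy \<Omega> \<epsilon> B (u n) (U n)
         - (L2_nrm \<Omega> (\<lambda>x. U (Suc n) x - U n x))\<^sup>2
         - dt * A_form \<Omega> (\<lambda>x. M (u n x)) (w (Suc n)) (w (Suc n))
         - 1 / 2 * A_form \<Omega> (\<lambda>_. \<epsilon>\<^sup>2) (\<lambda>x. u (Suc n) x - u n x) (\<lambda>x. u (Suc n) x - u n x)"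
      if n: "n < N" for n
    proof -
      have in_V: "u n \<in> V" "U n \<in> V" using mem[of n] n by auto
      note sav_n = sav[OF in_V(1) adm[OF n]]
      have diff: "(\<lambda>x. f x - g x) = f - g" for f g :: "real ^ 'd \<Rightarrow> real"
        by (simp add: fun_eq_iff)
      have norm: "(L2_nrm \<Omega> f)\<^sup>2 = L2_inner \<Omega> f f" for f
        unfolding L2_nrm_def L2_inner_def by (simp add: Bochner_Integration.integral_nonneg)
      have square: "(LINT x|lebesgue_on \<Omega>. (f x)\<^sup>2) = L2_inner \<Omega> f f" for f
        by (simp add: L2_inner_def power2_eq_square)
      from sav_scheme.energy_law[OF sav_n in_V step[OF n, unfolded scheme_step_iff[OF sav_n]]]
      show ?thesis unfolding energy_def diff norm square by linarith
    qed
    then show ?thesis using init mass by blast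
  qed
  ultimately show ?thesis by blast
qed

end
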